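(* Let $\Omega$ be a Polish space and $T\in\mathscr{L}(\mathscr{M}(\Omega),\sigma)$ with transition kernel $k$ such that $k(x,\cdot)$ is a probability measure for every $x\in\Omega$ and the measures $k(x,\cdot)$, $k(y,\cdot)$ are equivalent for all $x,y\in\Omega$. If there exists a probability measure $\mu$ with $T\mu=\mu$, then $\lim_{n\to\infty}T^n\nu=\nu(\Omega)\,\mu$ in the total variation norm for every $\nu\in\mathscr{M}(\Omega)$.
   Context: $\mathscr{M}(\Omega)$: finite signed Borel measures with total variation norm. $T$ is weakly continuous with kernel $k$ if $k:\Omega\times\mathscr{B}(\Omega)\to\mathbb{R}$ is a bounded transition kernel (signed measure in the second variable, Borel measurable in the first, $\sup_x\lvert k\rvert(x,\Omega)<\infty$) and $(T\mu)(A)=\int k(x,A)\,d\mu(x)$; $\mathscr{L}(\mathscr{M}(\Omega),\sigma)$ is the space of such operators. Two measures are equivalent if they are mutually absolutely continuous. *)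

theory Defs
  imports "HOL-Probability.Probability"
begin

text \<open>Finite signed Borel measures on a space of type 'a are represented as real-valued
  set functions on the Borel sets that vanish on the empty set and are countably additive.
  (Real values make them automatically finite.)\<close>

definition signed_measure :: "('a::topological_space set \<Rightarrow> real) \<Rightarrow> bool" where
  "signed_measure \<nu> \<longleftrightarrow> \<nu> {} = 0 \<and>
     (\<forall>A :: nat \<Rightarrow> 'a set. range A \<subseteq> sets borel \<longrightarrow> disjoint_family A \<longrightarrow>
        (\<lambda>n. \<nu> (A n)) sums \<nu> (\<Union>n. A n))"

definition tv_norm :: "('a::topological_space set \<Rightarrow> real) \<Rightarrow> real" where
  "tv_norm \<nu> = Sup {\<Sum>i<n. \<bar>\<nu> (P i)\<bar> | n (P :: nat \<Rightarrow> 'a set). (\<forall>i<n. P i \<in> sets borel) \<and> disjoint_family_on P {..<n}}"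

definition jordan_pos :: "('a::topological_space set \<Rightarrow> real) \<Rightarrow> 'a measure" where
  "jordan_pos \<nu> = measure_of UNIV (sets borel)
     (\<lambda>A. ennreal (Sup {\<nu> B | B. B \<in> sets borel \<and> B \<subseteq> A}))"

definition jordan_neg :: "('a::topological_space set \<Rightarrow> real) \<Rightarrow> 'a measure" where
  "jordan_neg \<nu> = measure_of UNIV (sets borel)
     (\<lambda>A. ennreal (Sup {- \<nu> B | B. B \<in> sets borel \<and> B \<subseteq> A}))"

definition signed_integral :: "('a::topological_space set \<Rightarrow> real) \<Rightarrow> ('a \<Rightarrow> real) \<Rightarrow> real" where
  "signed_integral \<nu> f = (\<integral>x. f x \<partial>jordan_pos \<nu>) - (\<integral>x. f x \<partial>jordan_neg \<nu>)"

definition kernel_op :: "('a::topological_space \<Rightarrow> 'a measure) \<Rightarrow> ('a set \<Rightarrow> real) \<Rightarrow> ('a set \<Rightarrow> real)" where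
  "kernel_op k \<nu> = (\<lambda>A. signed_integral \<nu> (\<lambda>x. measure (k x) A))"

end

theory Submission
  imports Defs
begin

text \<open>
  Let \<open>d\<^sub>n(x, y)\<close> be the supremum of \<open>\<bar>k\<^sup>j(x, A) - k\<^sup>j(y, A)\<bar>\<close> over all \<open>j \<ge> n\<close> and Borel \<open>A\<close>, and
  \<open>h\<close> the decreasing limit of the \<open>d\<^sub>n\<close>. Conditioning on the first step of two independent copies of
  the chain shows that \<open>h\<close> is subharmonic for the product kernel. That kernel has the invariant
  measure \<open>\<mu> \<otimes> \<mu>\<close>, to which all its transition probabilities are equivalent, so \<open>h\<close> is bounded by its
  mean \<open>m\<close> and attains it at some \<open>(x, y)\<close>. Cancelling the common part of \<open>k(x, \<cdot>)\<close> and \<open>k(y, \<cdot>)\<close>, which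
  is nonzero by equivalence, leaves measures of mass \<open>s < 1\<close> and gives \<open>m = h(x, y) \<le> s m\<close>. Hence
  \<open>m = 0\<close>, so \<open>d\<^sub>n \<rightarrow> 0\<close> pointwise, and integrating \<open>d\<^sub>n\<close> against \<open>\<mu>\<close> and the Jordan parts of \<open>\<nu>\<close>
  bounds the total variation.
\<close>

subsection \<open>Signed measures\<close>

lemma signed_measure_empty: "signed_measure \<nu> \<Longrightarrow> \<nu> {} = 0"
  by (simp add: signed_measure_def)

lemma signed_measure_sums:
  assumes "signed_measure \<nu>" "\<And>i::nat. A i \<in> sets borel" "disjoint_family A"
  shows "(\<lambda>i. \<nu> (A i)) sums \<nu> (\<Union>i. A i)"
  using assms unfolding signed_measure_def by blast

lemma signed_measure_Un:
  assumes "signed_measure \<nu>" "A \<in> sets borel" "B \<in> sets borel" "A \<inter> B = {}"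
  shows "\<nu> (A \<union> B) = \<nu> A + \<nu> B"
proof -
  have "(\<lambda>i. \<nu> (binaryset A B i)) sums \<nu> (\<Union>i. binaryset A B i)"
  proof (rule signed_measure_sums[OF assms(1)])
    show "binaryset A B i \<in> sets borel" for i
      using assms(2,3) by (simp add: binaryset_def)
    show "disjoint_family (binaryset A B)"
      using assms(4) by (auto simp: disjoint_family_on_def binaryset_def)
  qed
  moreover have "(\<lambda>i. \<nu> (binaryset A B i)) sums (\<nu> A + \<nu> B)"
    by (rule binaryset_sums) (rule signed_measure_empty[OF assms(1)])
  ultimately show ?thesis
    by (simp add: UN_binaryset_eq sums_unique2)
qed

lemma signed_measure_Diff:
  assumes "signed_measure \<nu>" "A \<in> sets borel" "B \<in> sets borel" "B \<subseteq> A"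
  shows "\<nu> (A - B) = \<nu> A - \<nu> B"
proof -
  have "\<nu> (B \<union> (A - B)) = \<nu> B + \<nu> (A - B)"
    using assms by (intro signed_measure_Un) auto
  moreover have "B \<union> (A - B) = A"
    using assms by auto
  ultimately show ?thesis by simp
qed

text \<open>Call a Borel set bad if \<nu> is unbounded on its Borel subsets. From a bad set a piece
  of absolute value at least 1 can be removed so that the rest is still bad. Were the whole space
  bad, infinitely many such pieces would be disjoint, and the terms of the convergent series of
  their values would not tend to zero.\<close>

lemma signed_measure_bounded:
  fixes \<nu> :: "'a::topological_space set \<Rightarrow> real"
  assumes sm: "signed_measure \<nu>"
  obtains c where "\<And>B. B \<in> sets borel \<Longrightarrow> \<bar>\<nu> B\<bar> \<le> c"
proof -
  define bad where "bad (A :: 'a set) \<longleftrightarrow> A \<in> sets borel \<and> (\<forall>c. \<exists>B\<in>sets borel. B \<subseteq> A \<and> \<bar>\<nu> B\<bar> > c)" for A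
  have split: "\<exists>C. bad C \<and> C \<subseteq> A \<and> \<bar>\<nu> (A - C)\<bar> \<ge> 1" if "bad A" for A
  proof -
    have A: "A \<in> sets borel" using that by (simp add: bad_def)
    \<comment> \<open>The margin \<open>\<bar>\<nu> A\<bar> + 1\<close> gives both \<open>B\<close>
      and \<open>A - B\<close> an absolute value above 1, so whichever of the two is bad can be kept
      and the other removed.\<close>
    have "\<exists>B\<in>sets borel. B \<subseteq> A \<and> \<bar>\<nu> B\<bar> > \<bar>\<nu> A\<bar> + 1"
      using that by (simp add: bad_def)
    then obtain B where B: "B \<in> sets borel" "B \<subseteq> A" "\<bar>\<nu> B\<bar> > \<bar>\<nu> A\<bar> + 1"
      by blast
    have diff: "\<nu> (A - B) = \<nu> A - \<nu> B"
      by (rule signed_measure_Diff[OF sm A B(1,2)])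
    show ?thesis
    proof (cases "bad B")
      case True
      then show ?thesis using B diff by (intro exI[of _ B]) auto
    next
      case False
      then obtain c where c: "\<And>D. D \<in> sets borel \<Longrightarrow> D \<subseteq> B \<Longrightarrow> \<bar>\<nu> D\<bar> \<le> c"
        using B(1) unfolding bad_def by (meson not_le)
      \<comment> \<open>If \<nu> is bounded by \<open>c\<close> inside \<open>B\<close>, a subset
        \<open>D\<close> of \<open>A\<close> with value beyond \<open>e + c\<close> still has value
        beyond \<open>e\<close> outside \<open>B\<close>.\<close>
      have "bad (A - B)"
        unfolding bad_def
      proof (intro conjI allI)
        show "A - B \<in> sets borel" using A B by auto
        fix e
        have "\<exists>D\<in>sets borel. D \<subseteq> A \<and> \<bar>\<nu> D\<bar> > e + c"
          using \<open>bad A\<close> by (simp add: bad_def)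
        then obtain D where D: "D \<in> sets borel" "D \<subseteq> A" "\<bar>\<nu> D\<bar> > e + c"
          by blast
        have "\<nu> (D \<inter> B \<union> (D - B)) = \<nu> (D \<inter> B) + \<nu> (D - B)"
          using D B by (intro signed_measure_Un[OF sm]) auto
        moreover have "D \<inter> B \<union> (D - B) = D" by auto
        moreover have "\<bar>\<nu> (D \<inter> B)\<bar> \<le> c" using D B by (intro c) auto
        ultimately have "\<bar>\<nu> (D - B)\<bar> > e" using D(3) by auto
        then show "\<exists>D'\<in>sets borel. D' \<subseteq> A - B \<and> e < \<bar>\<nu> D'\<bar>"
          using D B by (intro bexI[of _ "D - B"]) auto
      qed
      moreover have "A - (A - B) = B" using B by auto
      ultimately show ?thesis using B(3) by (intro exI[of _ "A - B"]) auto
    qed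
  qed
  have "\<not> bad UNIV"
  proof
    assume "bad UNIV"
    then have "\<exists>f. \<forall>n. bad (f n) \<and> (f (Suc n) \<subseteq> f n \<and> \<bar>\<nu> (f n - f (Suc n))\<bar> \<ge> 1)"
      using split by (intro dependent_nat_choice) auto
    then obtain f where f: "\<And>n. bad (f n)" "\<And>n. f (Suc n) \<subseteq> f n"
      "\<And>n. \<bar>\<nu> (f n - f (Suc n))\<bar> \<ge> 1" by blast
    have "decseq f" using f(2) by (rule decseq_SucI)
    have "disjoint_family (\<lambda>n. f n - f (Suc n))"
      unfolding disjoint_family_on_def
    proof (intro ballI impI)
      fix m n :: nat assume "m \<noteq> n"
      then show "(f m - f (Suc m)) \<inter> (f n - f (Suc n)) = {}"
        using decseqD[OF \<open>decseq f\<close>, of "Suc m" n] decseqD[OF \<open>decseq f\<close>, of "Suc n" m]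
        by (cases "m < n") auto
    qed
    then have "(\<lambda>n. \<nu> (f n - f (Suc n))) sums \<nu> (\<Union>n. f n - f (Suc n))"
      using f(1) by (intro signed_measure_sums[OF sm]) (auto simp: bad_def)
    then have "(\<lambda>n. \<nu> (f n - f (Suc n))) \<longlonglongrightarrow> 0"
      using sums_summable summable_LIMSEQ_zero by blast
    from tendstoD[OF this, of 1] have "\<forall>\<^sub>F n in sequentially. \<bar>\<nu> (f n - f (Suc n))\<bar> < 1"
      by (simp add: dist_real_def)
    then show False using f(3) by (auto simp: eventually_sequentially not_less[symmetric])
  qed
  then obtain c where "\<And>B. B \<in> sets borel \<Longrightarrow> \<bar>\<nu> B\<bar> \<le> c"
    unfolding bad_def by (auto simp: not_less)
  then show ?thesis by (rule that)
qed

section \<open>Jordan decomposition of a signed measure\<close>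

lemma signed_measure_uminus: "signed_measure \<nu> \<Longrightarrow> signed_measure (\<lambda>A. - \<nu> A)"
  unfolding signed_measure_def by (auto intro: sums_minus)

lemma jordan_neg_eq: "jordan_neg \<nu> = jordan_pos (\<lambda>A. - \<nu> A)"
  by (simp add: jordan_neg_def jordan_pos_def)

lemma sets_jordan_pos [simp]: "sets (jordan_pos \<nu>) = sets borel"
  unfolding jordan_pos_def using sets.sigma_sets_eq[of borel] by simp

lemma space_jordan_pos [simp]: "space (jordan_pos \<nu>) = UNIV"
  using sets_eq_imp_space_eq[OF sets_jordan_pos] by simp

text \<open>\<open>measure_of\<close> returns the given set function only when it is a measure, so
  the supremum has to be shown countably additive. Superadditivity on disjoint sets comes from
  uniting subsets; the reverse inequality comes from cutting a Borel subset of the union along the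
  pieces \<open>F i\<close>. Boundedness of \<nu> makes the real suprema meaningful.\<close>

lemma emeasure_jordan_pos:
  fixes \<nu> :: "'a::topological_space set \<Rightarrow> real"
  assumes sm: "signed_measure \<nu>" and A: "A \<in> sets borel"
  shows "emeasure (jordan_pos \<nu>) A = ennreal (Sup {\<nu> B | B. B \<in> sets borel \<and> B \<subseteq> A})"
proof -
  define p where "p A = Sup {\<nu> B | B. B \<in> sets borel \<and> B \<subseteq> A}" for A
  obtain c where c: "\<And>B. B \<in> sets borel \<Longrightarrow> \<bar>\<nu> B\<bar> \<le> c"
    using signed_measure_bounded[OF sm] by blast
  have upper: "\<nu> B \<le> p A" if "B \<in> sets borel" "B \<subseteq> A" for A B
    unfolding p_def
  proof (rule cSup_upper)
    show "\<nu> B \<in> {\<nu> B |B. B \<in> sets borel \<and> B \<subseteq> A}" using that by blast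
    show "bdd_above {\<nu> B |B. B \<in> sets borel \<and> B \<subseteq> A}"
      using c by (auto simp: bdd_above_def abs_le_iff)
  qed
  have least: "p A \<le> e" if "\<And>B. B \<in> sets borel \<Longrightarrow> B \<subseteq> A \<Longrightarrow> \<nu> B \<le> e" for A e
    unfolding p_def by (rule cSup_least) (use that in auto)
  have nonneg: "0 \<le> p A" for A
    using upper[of "{}" A] signed_measure_empty[OF sm] by simp
  have mono: "p A \<le> p B" if "A \<subseteq> B" for A B
    using that by (intro least upper) auto
  have super: "p A + p B \<le> p (A \<union> B)" if "A \<inter> B = {}" for A B
  proof -
    have "\<nu> D \<le> p (A \<union> B) - \<nu> C" if "C \<in> sets borel" "C \<subseteq> A" "D \<in> sets borel" "D \<subseteq> B" for C D
    proof -
      have "\<nu> C + \<nu> D = \<nu> (C \<union> D)"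
        using that \<open>A \<inter> B = {}\<close> by (intro signed_measure_Un[OF sm, symmetric]) auto
      also have "\<dots> \<le> p (A \<union> B)" using that by (intro upper) auto
      finally show ?thesis by simp
    qed
    then have "p B \<le> p (A \<union> B) - \<nu> C" if "C \<in> sets borel" "C \<subseteq> A" for C
      using that by (intro least) auto
    then have "\<nu> C \<le> p (A \<union> B) - p B" if "C \<in> sets borel" "C \<subseteq> A" for C
      using that by force
    then have "p A \<le> p (A \<union> B) - p B" by (intro least) auto
    then show ?thesis by simp
  qed
  have "countably_additive (sets borel) (\<lambda>A. ennreal (p A))"
  proof (rule countably_additiveI)
    fix F :: "nat \<Rightarrow> 'a set"
    assume F: "range F \<subseteq> sets borel" "disjoint_family F" "(\<Union>i. F i) \<in> sets borel"
    let ?U = "\<Union>i. F i"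
    have partial: "(\<Sum>i<n. p (F i)) \<le> p (\<Union>i<n. F i)" for n
    proof (induction n)
      case (Suc n)
      have "(\<Union>i<n. F i) \<inter> F n = {}"
        using disjoint_family_onD[OF F(2) UNIV_I UNIV_I, of _ n] by (auto simp: disjoint_iff) (metis less_irrefl)
      then have "p (\<Union>i<n. F i) + p (F n) \<le> p ((\<Union>i<n. F i) \<union> F n)"
        by (rule super)
      also have "(\<Union>i<n. F i) \<union> F n = (\<Union>i<Suc n. F i)"
        by (auto simp: less_Suc_eq)
      finally show ?case using Suc by simp
    qed (simp add: nonneg)
    have partial': "(\<Sum>i<n. p (F i)) \<le> p ?U" for n
      by (rule order_trans[OF partial mono]) auto
    have sm_F: "summable (\<lambda>i. p (F i))"
      by (rule summableI_nonneg_bounded[OF nonneg partial'])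
    have "(\<Sum>i. p (F i)) \<le> p ?U"
      by (rule suminf_le_const[OF sm_F partial'])
    moreover have "p ?U \<le> (\<Sum>i. p (F i))"
    proof (rule least)
      fix B assume B: "B \<in> sets borel" "B \<subseteq> ?U"
      have "(\<lambda>i. \<nu> (B \<inter> F i)) sums \<nu> (\<Union>i. B \<inter> F i)"
        using F B by (intro signed_measure_sums[OF sm]) (auto simp: disjoint_family_on_def)
      moreover have "(\<Union>i. B \<inter> F i) = B" using B by auto
      ultimately have s: "(\<lambda>i. \<nu> (B \<inter> F i)) sums \<nu> B" by simp
      show "\<nu> B \<le> (\<Sum>i. p (F i))"
        using F B by (intro sums_le[OF _ s summable_sums[OF sm_F]] upper) auto
    qed
    ultimately have "(\<Sum>i. p (F i)) = p ?U" by (rule antisym)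
    then show "(\<Sum>i. ennreal (p (F i))) = ennreal (p ?U)"
      using nonneg sm_F by (simp add: suminf_ennreal2)
  qed
  moreover have "p {} = 0"
    using signed_measure_empty[OF sm] nonneg[of "{}"] least[of "{}" 0] by fastforce
  ultimately show ?thesis
    using A sets.sigma_algebra_axioms[of "borel :: 'a measure"]
    unfolding jordan_pos_def
    by (subst emeasure_measure_of_sigma) (auto simp: p_def positive_def)
qed

lemma finite_measure_jordan_pos: "signed_measure \<nu> \<Longrightarrow> finite_measure (jordan_pos \<nu>)"
  by (rule finite_measureI) (simp add: emeasure_jordan_pos)

lemma measure_jordan_pos:
  assumes sm: "signed_measure \<nu>" and A: "A \<in> sets borel"
  shows "measure (jordan_pos \<nu>) A = Sup {\<nu> B | B. B \<in> sets borel \<and> B \<subseteq> A}"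
proof -
  obtain c where c: "\<And>B. B \<in> sets borel \<Longrightarrow> \<bar>\<nu> B\<bar> \<le> c"
    using signed_measure_bounded[OF sm] by blast
  have "0 \<le> Sup {\<nu> B | B. B \<in> sets borel \<and> B \<subseteq> A}"
    using c signed_measure_empty[OF sm]
    by (intro cSup_upper) (auto simp: bdd_above_def abs_le_iff intro!: exI[of _ "{}"])
  then show ?thesis by (simp add: measure_def emeasure_jordan_pos[OF assms])
qed

text \<open>Replacing \<open>B\<close> by \<open>A - B\<close> turns \<open>- \<nu> B\<close> into
  \<open>- \<nu> A + \<nu> (A - B)\<close>. Hence the supremum for the negative part is the one for
  the positive part shifted by \<open>- \<nu> A\<close>.\<close>

lemma jordan_decomposition:
  assumes sm: "signed_measure \<nu>" and A: "A \<in> sets borel"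
  shows "\<nu> A = measure (jordan_pos \<nu>) A - measure (jordan_neg \<nu>) A"
proof -
  obtain c where c: "\<And>B. B \<in> sets borel \<Longrightarrow> \<bar>\<nu> B\<bar> \<le> c"
    using signed_measure_bounded[OF sm] by blast
  let ?S = "{\<nu> B | B. B \<in> sets borel \<and> B \<subseteq> A}"
  have bdd: "bdd_above ?S" using c by (auto simp: bdd_above_def abs_le_iff)
  have "{- \<nu> B | B. B \<in> sets borel \<and> B \<subseteq> A} = (\<lambda>r. - \<nu> A + r) ` ?S" (is "?T = _")
  proof (intro equalityI subsetI)
    fix r assume "r \<in> ?T"
    then obtain B where B: "r = - \<nu> B" "B \<in> sets borel" "B \<subseteq> A" by blast
    then have "r = - \<nu> A + \<nu> (A - B)" using signed_measure_Diff[OF sm A B(2,3)] by simp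
    then show "r \<in> (\<lambda>r. - \<nu> A + r) ` ?S" using A B by blast
  next
    fix r assume "r \<in> (\<lambda>r. - \<nu> A + r) ` ?S"
    then obtain B where B: "r = - \<nu> A + \<nu> B" "B \<in> sets borel" "B \<subseteq> A" by blast
    then have "r = - \<nu> (A - B)" using signed_measure_Diff[OF sm A B(2,3)] by simp
    then show "r \<in> ?T" using A B by blast
  qed
  moreover have "Sup ((\<lambda>r. - \<nu> A + r) ` ?S) = - \<nu> A + Sup ?S"
    using bdd Sup_add_eq[of "\<lambda>r. r" ?S "- \<nu> A"] by auto
  ultimately show ?thesis
    unfolding jordan_neg_eq using sm A
    by (simp add: measure_jordan_pos signed_measure_uminus)
qed

section \<open>Total variation, and integrals computed from an arbitrary decomposition\<close>

lemma sum_abs_disjoint_le: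
  fixes \<rho> :: "'a::topological_space set \<Rightarrow> real" and P :: "nat \<Rightarrow> 'a set"
  assumes add: "\<And>A B. A \<in> sets borel \<Longrightarrow> B \<in> sets borel \<Longrightarrow> A \<inter> B = {} \<Longrightarrow> \<rho> (A \<union> B) = \<rho> A + \<rho> B"
    and bound: "\<And>A. A \<in> sets borel \<Longrightarrow> \<bar>\<rho> A\<bar> \<le> c"
    and P: "\<And>i. i < n \<Longrightarrow> P i \<in> sets borel" "disjoint_family_on P {..<n}"
  shows "(\<Sum>i<n. \<bar>\<rho> (P i)\<bar>) \<le> 2 * c"
proof -
  have empty: "\<rho> {} = 0" using add[of "{}" "{}"] by simp
  have sum_eq: "\<rho> (\<Union>i\<in>I. P i) = (\<Sum>i\<in>I. \<rho> (P i))" if "I \<subseteq> {..<n}" for I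
  proof -
    have "finite I" by (rule finite_subset[OF that]) simp
    then show ?thesis using that
    proof (induction I rule: finite_induct)
      case (insert i I)
      have "P i \<inter> (\<Union>j\<in>I. P j) = {}"
        using insert disjoint_family_onD[OF P(2), of i] by fastforce
      moreover have "(\<Union>j\<in>I. P j) \<in> sets borel" "P i \<in> sets borel"
        using insert P(1) by (auto intro!: sets.finite_UN)
      ultimately have "\<rho> (P i \<union> (\<Union>j\<in>I. P j)) = \<rho> (P i) + \<rho> (\<Union>j\<in>I. P j)"
        by (intro add)
      then show ?case using insert by simp
    qed (simp add: empty)
  qed
  \<comment> \<open>Grouping the indices by the sign of \<open>\<rho> (P i)\<close> turns the sum
    into a difference of two values of \<rho>, one for each union. This is where the factor 2 comes
    from.\<close>
  let ?I = "{i\<in>{..<n}. 0 \<le> \<rho> (P i)}" and ?J = "{i\<in>{..<n}. \<not> 0 \<le> \<rho> (P i)}"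
  have "(\<Sum>i<n. \<bar>\<rho> (P i)\<bar>) = (\<Sum>i\<in>?I. \<bar>\<rho> (P i)\<bar>) + (\<Sum>i\<in>?J. \<bar>\<rho> (P i)\<bar>)"
    by (subst sum.union_disjoint[symmetric]) (auto intro!: sum.cong)
  also have "\<dots> = (\<Sum>i\<in>?I. \<rho> (P i)) - (\<Sum>i\<in>?J. \<rho> (P i))"
    by (simp add: sum_negf[symmetric])
  also have "\<dots> = \<rho> (\<Union>i\<in>?I. P i) - \<rho> (\<Union>i\<in>?J. P i)"
    by (subst (1 2) sum_eq) auto
  also have "\<dots> \<le> 2 * c"
  proof -
    have "(\<Union>i\<in>?I. P i) \<in> sets borel" "(\<Union>i\<in>?J. P i) \<in> sets borel"
      using P(1) by (auto intro!: sets.finite_UN)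
    then have "\<bar>\<rho> (\<Union>i\<in>?I. P i)\<bar> \<le> c" "\<bar>\<rho> (\<Union>i\<in>?J. P i)\<bar> \<le> c"
      by (auto dest: bound)
    then show ?thesis by linarith
  qed
  finally show ?thesis .
qed

text \<open>Passes from a bound uniform over Borel sets to the norm. The lower estimate relies on it
  too, since a real \<open>Sup\<close> is informative only for a set bounded above.\<close>

lemma tv_norm_bounds:
  fixes \<rho> :: "'a::topological_space set \<Rightarrow> real"
  assumes add: "\<And>A B. A \<in> sets borel \<Longrightarrow> B \<in> sets borel \<Longrightarrow> A \<inter> B = {} \<Longrightarrow> \<rho> (A \<union> B) = \<rho> A + \<rho> B"
    and bound: "\<And>A. A \<in> sets borel \<Longrightarrow> \<bar>\<rho> A\<bar> \<le> c"
  shows "0 \<le> tv_norm \<rho>" "tv_norm \<rho> \<le> 2 * c"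
proof -
  let ?S = "{\<Sum>i<n. \<bar>\<rho> (P i)\<bar> | n (P :: nat \<Rightarrow> 'a set).
    (\<forall>i<n. P i \<in> sets borel) \<and> disjoint_family_on P {..<n}}"
  have le: "r \<le> 2 * c" if "r \<in> ?S" for r
    using that sum_abs_disjoint_le[of \<rho>, OF add bound] by blast
  have zero: "0 \<in> ?S"
    by (rule CollectI, rule exI[of _ 0], rule exI[of _ "\<lambda>_. {}"]) (simp add: disjoint_family_on_def)
  show "0 \<le> tv_norm \<rho>"
    unfolding tv_norm_def using zero le by (intro cSup_upper) (auto simp: bdd_above_def)
  show "tv_norm \<rho> \<le> 2 * c"
    unfolding tv_norm_def using zero le by (intro cSup_least) blast+
qed

text \<open>Comparing sums of two measures instead of differences avoids subtraction in
  \<open>ennreal\<close>, so the standard induction over measurable functions applies.\<close>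

lemma nn_integral_sum_measures_eq:
  assumes "sets M\<^sub>1 = sets N" "sets M\<^sub>2 = sets N" "sets M\<^sub>3 = sets N" "sets M\<^sub>4 = sets N"
    and eq: "\<And>A. A \<in> sets N \<Longrightarrow> emeasure M\<^sub>1 A + emeasure M\<^sub>2 A = emeasure M\<^sub>3 A + emeasure M\<^sub>4 A"
    and f: "f \<in> borel_measurable N"
  shows "(\<integral>\<^sup>+x. f x \<partial>M\<^sub>1) + (\<integral>\<^sup>+x. f x \<partial>M\<^sub>2) = (\<integral>\<^sup>+x. f x \<partial>M\<^sub>3) + (\<integral>\<^sup>+x. f x \<partial>M\<^sub>4)"
  using f
proof (induction rule: borel_measurable_induct)
  note [measurable_cong] = assms(1-4)
  note [simp] = assms(1-4)
  note [simp] = assms(1-4)[THEN sets_eq_imp_space_eq]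
  {
    case (cong f g)
    then have "integral\<^sup>N M f = integral\<^sup>N M g" if "space M = space N" for M
      using that by (intro nn_integral_cong) simp
    with cong show ?case by simp
  next
    case (set A)
    then show ?case by (simp add: eq)
  next
    case (mult u c)
    then show ?case by (simp add: nn_integral_cmult distrib_left[symmetric])
  next
    case (add u v)
    then show ?case by (simp add: nn_integral_add) (metis add.assoc add.left_commute)
  next
    case (seq U)
    have "(\<integral>\<^sup>+x. (SUP i. U i) x \<partial>M) = (SUP i. \<integral>\<^sup>+x. U i x \<partial>M)"
      "incseq (\<lambda>i. \<integral>\<^sup>+x. U i x \<partial>M)" if [measurable_cong]: "sets M = sets N" for M
      using seq by (auto simp: SUP_apply[abs_def] nn_integral_monotone_convergence_SUP incseq_def le_fun_def
        intro!: nn_integral_mono)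
    then show ?case using seq.IH by (simp add: ennreal_SUP_add[symmetric])
  }
qed

text \<open>\<open>signed_integral\<close> is defined by the Jordan parts, whereas iterating the
  operator produces differences of measures that need not be mutually singular. Rearranged, the two
  decompositions say that \<open>jordan_pos \<nu> + N\<close> and
  \<open>P + jordan_neg \<nu>\<close> agree on Borel sets. The bounded integrand makes all four
  integrals finite, so they can be moved back across the equation.\<close>

lemma signed_integral_eq:
  assumes sm: "signed_measure \<nu>"
    and P: "finite_measure P" "sets P = sets borel" and N: "finite_measure N" "sets N = sets borel"
    and eq: "\<And>A. A \<in> sets borel \<Longrightarrow> \<nu> A = measure P A - measure N A"
    and f[measurable]: "f \<in> borel_measurable borel" and f01: "\<And>x. 0 \<le> f x" "\<And>x. f x \<le> 1"
  shows "signed_integral \<nu> f = (\<integral>x. f x \<partial>P) - (\<integral>x. f x \<partial>N)"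
proof -
  have J: "finite_measure (jordan_pos \<nu>)" "finite_measure (jordan_neg \<nu>)"
    unfolding jordan_neg_eq using sm by (auto intro: finite_measure_jordan_pos signed_measure_uminus)
  have sets_neg: "sets (jordan_neg \<nu>) = sets borel" by (simp add: jordan_neg_eq)
  have nn: "(\<integral>\<^sup>+x. ennreal (f x) \<partial>M) = ennreal (\<integral>x. f x \<partial>M)"
    if "finite_measure M" "sets M = sets borel" for M
  proof (rule nn_integral_eq_integral)
    interpret finite_measure M by fact
    note [measurable_cong] = \<open>sets M = sets borel\<close>
    show "integrable M f" by (rule integrable_const_bound[where B=1]) (use f01 in auto)
  qed (use f01 in auto)
  have "(\<integral>\<^sup>+x. ennreal (f x) \<partial>jordan_pos \<nu>) + (\<integral>\<^sup>+x. ennreal (f x) \<partial>N)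
      = (\<integral>\<^sup>+x. ennreal (f x) \<partial>P) + (\<integral>\<^sup>+x. ennreal (f x) \<partial>jordan_neg \<nu>)"
  proof (rule nn_integral_sum_measures_eq[where N=borel])
    fix A :: "'a set" assume A: "A \<in> sets borel"
    have "measure (jordan_pos \<nu>) A + measure N A = measure P A + measure (jordan_neg \<nu>) A"
      using eq[OF A] jordan_decomposition[OF sm A] by simp
    then show "emeasure (jordan_pos \<nu>) A + emeasure N A = emeasure P A + emeasure (jordan_neg \<nu>) A"
      using J P N by (simp add: finite_measure.emeasure_eq_measure ennreal_plus[symmetric] del: ennreal_plus)
  qed (use P N sets_neg in auto)
  then have "(\<integral>x. f x \<partial>jordan_pos \<nu>) + (\<integral>x. f x \<partial>N) = (\<integral>x. f x \<partial>P) + (\<integral>x. f x \<partial>jordan_neg \<nu>)"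
    using J P N sets_neg f01
    by (simp add: nn ennreal_plus[symmetric] integral_nonneg_AE del: ennreal_plus)
  then show ?thesis by (simp add: signed_integral_def)
qed

subsection \<open>Probability measures and subharmonic functions\<close>

text \<open>The class consists of the finite unions from a countable basis. A bound on it passes to
  open sets by increasing limits and then to Borel sets by outer regularity. Its purpose is
  measurability: a supremum over all Borel sets can be replaced by one over a countable
  class.\<close>

lemma countable_class_determining_distance:
  obtains \<C> :: "'a::polish_space set set"
  where "countable \<C>" "\<C> \<subseteq> sets borel" "\<C> \<noteq> {}"
    "\<And>P Q c A. finite_measure P \<Longrightarrow> sets P = sets borel \<Longrightarrow> finite_measure Q \<Longrightarrow> sets Q = sets borel \<Longrightarrow>
      (\<And>B. B \<in> \<C> \<Longrightarrow> \<bar>measure P B - measure Q B\<bar> \<le> c) \<Longrightarrow> A \<in> sets borel \<Longrightarrow>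
      \<bar>measure P A - measure Q A\<bar> \<le> c"
proof -
  obtain \<B> :: "'a set set" where \<B>: "countable \<B>" "topological_basis \<B>"
    using ex_countable_basis by blast
  define \<C> where "\<C> = Union ` {F. finite F \<and> F \<subseteq> \<B>}"
  have open_C: "open B" if "B \<in> \<C>" for B
    using that \<B>(2) by (auto simp: \<C>_def intro!: open_Union topological_basis_open)
  show ?thesis
  proof (rule that[of \<C>])
    show "countable \<C>"
      unfolding \<C>_def using \<B>(1) by (intro countable_image countable_Collect_finite_subset)
    show "\<C> \<subseteq> sets borel" using open_C by auto
    show "\<C> \<noteq> {}" by (auto simp: \<C>_def)
    fix P Q :: "'a measure" and c :: real and A :: "'a set"
    assume P: "finite_measure P" "sets P = sets borel" and Q: "finite_measure Q" "sets Q = sets borel"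
      and c: "\<And>B. B \<in> \<C> \<Longrightarrow> \<bar>measure P B - measure Q B\<bar> \<le> c" and A: "A \<in> sets borel"
    interpret P: finite_measure P by fact
    interpret Q: finite_measure Q by fact
    have open_le: "\<bar>measure P U - measure Q U\<bar> \<le> c" if "open U" for U
    proof -
      obtain S where S: "S \<subseteq> \<B>" "U = \<Union>S"
        using \<open>open U\<close> \<B>(2) unfolding topological_basis_def by blast
      show ?thesis
      proof (cases "S = {}")
        case True
        then show ?thesis using S by (intro c) (auto simp: \<C>_def)
      next
        case False
        have "countable S" using S(1) \<B>(1) by (rule countable_subset)
        define G where "G n = (\<Union>i\<le>n. from_nat_into S i)" for n
        have G: "G n \<in> \<C>" for n
          unfolding G_def \<C>_def
          using from_nat_into[OF False] S(1) by (intro imageI CollectI) auto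
        have "U = (\<Union>n. G n)"
        proof -
          have "(\<Union>n. G n) = \<Union>(range (from_nat_into S))" unfolding G_def by auto
          then show ?thesis using range_from_nat_into[OF False \<open>countable S\<close>] S(2) by simp
        qed
        moreover have "incseq G" unfolding G_def by (intro incseq_SucI) (auto simp: atMost_Suc)
        moreover have "range G \<subseteq> sets borel" using G open_C by auto
        ultimately have "(\<lambda>n. measure P (G n)) \<longlonglongrightarrow> measure P U" "(\<lambda>n. measure Q (G n)) \<longlonglongrightarrow> measure Q U"
          using P(2) Q(2) by (auto intro!: P.finite_Lim_measure_incseq Q.finite_Lim_measure_incseq)
        then have "(\<lambda>n. \<bar>measure P (G n) - measure Q (G n)\<bar>) \<longlonglongrightarrow> \<bar>measure P U - measure Q U\<bar>"
          by (intro tendsto_intros)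
        then show ?thesis
          by (rule LIMSEQ_le_const2) (use c[OF G] in auto)
      qed
    qed
    have approx: "\<exists>U. open U \<and> A \<subseteq> U \<and> measure R U < measure R A + e"
      if "0 < e" and R: "finite_measure R" "sets R = sets borel" for e and R :: "'a measure"
    proof -
      interpret R: finite_measure R by fact
      have "(INF U \<in> {U. A \<subseteq> U \<and> open U}. emeasure R U) = emeasure R A"
        using outer_regular[OF R(2) _ A] by simp
      also have "\<dots> < ennreal (measure R A + e)"
        using \<open>0 < e\<close> by (simp add: R.emeasure_eq_measure ennreal_less_iff)
      finally show ?thesis
        by (auto simp: INF_less_iff R.emeasure_eq_measure ennreal_less_iff)
    qed
    show "\<bar>measure P A - measure Q A\<bar> \<le> c"
    proof (rule field_le_epsilon)
      fix e :: real assume "0 < e"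
      \<comment> \<open>One open set is chosen for each measure; since \<open>U \<inter> V\<close>
        lies between \<open>A\<close> and both of them, it approximates \<open>A\<close> for
        \<open>P\<close> and \<open>Q\<close> at once.\<close>
      obtain U where U: "open U" "A \<subseteq> U" "measure P U < measure P A + e"
        using approx[OF \<open>0 < e\<close> P] by blast
      obtain V where V: "open V" "A \<subseteq> V" "measure Q V < measure Q A + e"
        using approx[OF \<open>0 < e\<close> Q] by blast
      have UV: "U \<inter> V \<in> sets borel" "U \<in> sets borel" "V \<in> sets borel"
        using U V by auto
      have "measure P A \<le> measure P (U \<inter> V)" "measure P (U \<inter> V) \<le> measure P U"
        "measure Q A \<le> measure Q (U \<inter> V)" "measure Q (U \<inter> V) \<le> measure Q V"
        using U V UV P Q by (auto intro!: P.finite_measure_mono Q.finite_measure_mono)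
      moreover have "\<bar>measure P (U \<inter> V) - measure Q (U \<inter> V)\<bar> \<le> c"
        using U V by (intro open_le open_Int)
      ultimately show "\<bar>measure P A - measure Q A\<bar> \<le> c + e"
        using U(3) V(3) by linarith
    qed
  qed
qed

text \<open>For the mean \<open>m\<close> of \<open>h\<close>, the positive part of \<open>h - m\<close> is again subharmonic, hence by
  invariance harmonic almost everywhere; by equivalence it is then either null or almost
  everywhere positive, and the latter contradicts the choice of \<open>m\<close>.\<close>

lemma subharmonic_le_mean:
  fixes h :: "'a \<Rightarrow> real"
  assumes q[measurable]: "q \<in> S \<rightarrow>\<^sub>M prob_algebra S"
    and \<pi>: "prob_space \<pi>" "sets \<pi> = sets S" "\<pi> \<bind> q = \<pi>"
    and equiv: "\<And>z P. z \<in> space S \<Longrightarrow> Measurable.pred S P \<Longrightarrow> (AE x in q z. P x) \<longleftrightarrow> (AE x in \<pi>. P x)"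
    and h[measurable]: "h \<in> borel_measurable S" and h01: "\<And>z. 0 \<le> h z" "\<And>z. h z \<le> 1"
    and sub: "\<And>z. z \<in> space S \<Longrightarrow> h z \<le> (\<integral>w. h w \<partial>q z)"
    and z: "z \<in> space S"
  shows "h z \<le> (\<integral>w. h w \<partial>\<pi>)"
proof -
  interpret \<pi>: prob_space \<pi> by fact
  note [measurable_cong] = \<pi>(2)
  have space_\<pi>: "space \<pi> = space S" using \<pi>(2) by (rule sets_eq_imp_space_eq)
  have q': "prob_space (q z)" "sets (q z) = sets S" if "z \<in> space S" for z
    using measurable_space[OF q that] by (auto simp: space_prob_algebra)
  have int: "integrable N f" if "prob_space N" "sets N = sets S" "f \<in> borel_measurable S"
    "\<And>z. \<bar>f z\<bar> \<le> 1" for N and f :: "'a \<Rightarrow> real"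
  proof -
    interpret N: prob_space N by fact
    show ?thesis
      using that by (intro N.integrable_const_bound[where B=1]) (auto cong: measurable_cong_sets)
  qed
  define m where "m = (\<integral>w. h w \<partial>\<pi>)"
  have int_h: "integrable \<pi> h" using h01 by (intro int \<pi>) auto
  have m: "0 \<le> m" "m \<le> 1"
    unfolding m_def using h01 int_h by (auto intro!: integral_nonneg_AE \<pi>.integral_le_const)
  define g where "g z = max 0 (h z - m)" for z
  have g01: "0 \<le> g z" "g z \<le> 1" for z using h01[of z] m by (auto simp: g_def)
  have [measurable]: "g \<in> borel_measurable S" unfolding g_def by measurable
  define G where "G z = (\<integral>w. g w \<partial>q z)" for z
  have [measurable]: "G \<in> borel_measurable S"
    unfolding G_def by (rule measurable_compose[OF measurable_prob_algebraD[OF q] integral_measurable_subprob_algebra]) simp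
  have G_ge: "g z \<le> G z" if "z \<in> space S" for z
  proof -
    interpret Q: prob_space "q z" by (rule q'[OF that])
    have ih: "integrable (q z) h" "integrable (q z) g"
      using h01 g01 by (auto intro!: int q'[OF that])
    have "h z - m \<le> (\<integral>w. h w \<partial>q z) - m" using sub[OF that] by simp
    also have "\<dots> = (\<integral>w. h w - m \<partial>q z)"
      using ih by (simp add: Q.prob_space)
    also have "\<dots> \<le> G z"
      unfolding G_def using ih by (intro integral_mono) (auto simp: g_def)
    finally have "h z - m \<le> G z" .
    moreover have "0 \<le> G z" unfolding G_def using g01 by (intro integral_nonneg_AE) auto
    ultimately show ?thesis by (simp add: g_def)
  qed
  have G_le: "\<bar>G z\<bar> \<le> 1" if "z \<in> space S" for z
  proof -
    interpret Q: prob_space "q z" by (rule q'[OF that])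
    have "G z \<le> 1" unfolding G_def using g01
      by (intro Q.integral_le_const int q'[OF that]) auto
    moreover have "0 \<le> G z" using G_ge[OF that] g01(1)[of z] by linarith
    ultimately show ?thesis by simp
  qed
  have int_g: "integrable \<pi> g" using g01 by (intro int \<pi>) auto
  have int_G: "integrable \<pi> G"
    using G_le by (intro \<pi>.integrable_const_bound[where B=1]) (auto simp: space_\<pi>)
  have "(\<integral>z. G z \<partial>\<pi>) = (\<integral>z. g z \<partial>(\<pi> \<bind> q))"
    unfolding G_def
  proof (rule integral_bind[symmetric, where K=S and B=1 and B'=1])
    show "q \<in> \<pi> \<rightarrow>\<^sub>M subprob_algebra S" using measurable_prob_algebraD[OF q] by measurable
    show "finite_measure \<pi>" by unfold_locales
    show "AE z in \<pi>. emeasure (q z) (space (q z)) \<le> ennreal 1"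
      using q'(1) by (auto simp: space_\<pi> prob_space.emeasure_space_1)
  qed (use g01 in auto)
  then have "(\<integral>z. G z - g z \<partial>\<pi>) = 0"
    using int_g int_G \<pi>(3) by simp
  then have "AE z in \<pi>. G z - g z = 0"
    using G_ge int_g int_G by (subst (asm) integral_nonneg_eq_0_iff_AE) (auto simp: space_\<pi>)
  then have G_eq: "AE z in \<pi>. G z = g z" by simp
  have g_null: "AE z in \<pi>. g z = 0"
  proof (rule ccontr)
    assume *: "\<not> ?thesis"
    have G_pos: "0 < G z" if z: "z \<in> space S" for z
    proof (rule ccontr)
      assume "\<not> 0 < G z"
      then have "G z = 0" using G_ge[OF z] g01(1)[of z] by linarith
      then have "AE w in q z. g w = 0"
        unfolding G_def using g01 by (subst (asm) integral_nonneg_eq_0_iff_AE) (auto intro!: int q'[OF z])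
      then have "AE w in \<pi>. g w = 0" using equiv[OF z] by simp
      with * show False by simp
    qed
    have "AE z in \<pi>. m < h z"
      using G_eq AE_space
    proof eventually_elim
      case (elim z)
      then show ?case using G_pos[of z] by (auto simp: space_\<pi> g_def split: if_splits)
    qed
    then have "AE z in \<pi>. - h z < - m" by simp
    then have "(\<integral>z. - h z \<partial>\<pi>) < - m" using int_h by (intro \<pi>.expectation_less) auto
    then show False by (simp add: m_def)
  qed
  then have "AE w in \<pi>. h w \<le> m"
    by eventually_elim (simp add: g_def max_def split: if_splits)
  \<comment> \<open>So far the bound is known only almost everywhere for \<pi>. Equivalence carries
    it to \<open>q z\<close>, and subharmonicity at \<open>z\<close> then yields it at the given
    point.\<close>
  then have *: "AE w in q z. h w \<le> m" using equiv[OF z] by simp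
  interpret Q: prob_space "q z" by (rule q'[OF z])
  have "h z \<le> (\<integral>w. h w \<partial>q z)" by (rule sub[OF z])
  also have "\<dots> \<le> m" using * h01 by (intro Q.integral_le_const int q'[OF z]) auto
  finally show ?thesis by (simp add: m_def)
qed

text \<open>With densities \<open>p\<close> and \<open>q\<close> relative to \<open>M\<close>, the
  common part cancels and leaves the positive parts \<open>u\<close> and \<open>v\<close> of
  \<open>p - q\<close> and \<open>q - p\<close>. They have equal mass \<open>s\<close>, and dividing
  by it gives \<open>R\<^sub>1\<close> and \<open>R\<^sub>2\<close>. The set \<open>B\<close> is
  exported so that \<open>s\<close> can later be compared with 1 through null sets.\<close>

lemma prob_density_difference:
  fixes M P Q :: "'a measure"
  assumes M: "prob_space M"
    and P: "prob_space P" "sets P = sets M" "absolutely_continuous M P"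
    and Q: "prob_space Q" "sets Q = sets M" "absolutely_continuous M Q"
  obtains s R\<^sub>1 R\<^sub>2 B where "0 \<le> s" "B \<in> sets M" "s = measure P B - measure Q B"
    "prob_space R\<^sub>1" "sets R\<^sub>1 = sets M" "prob_space R\<^sub>2" "sets R\<^sub>2 = sets M"
    "\<And>f::'a \<Rightarrow> real. f \<in> borel_measurable M \<Longrightarrow> (\<And>x. \<bar>f x\<bar> \<le> 1) \<Longrightarrow>
      (\<integral>x. f x \<partial>P) - (\<integral>x. f x \<partial>Q) = s * ((\<integral>x. f x \<partial>R\<^sub>1) - (\<integral>x. f x \<partial>R\<^sub>2))"
proof -
  interpret M: prob_space M by fact
  have dens: "\<exists>p. p \<in> borel_measurable M \<and> (\<forall>x. 0 \<le> p x) \<and> density M (\<lambda>x. ennreal (p x)) = N"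
    if N: "prob_space N" "sets N = sets M" "absolutely_continuous M N" for N
  proof -
    interpret N: prob_space N by fact
    obtain D where D: "D \<in> borel_measurable M" "AE x in M. RN_deriv M N x = ennreal (D x)" "\<And>x. 0 \<le> D x"
      using M.real_RN_deriv[OF N.finite_measure_axioms N(3,2)] by blast
    have "density M (\<lambda>x. ennreal (D x)) = density M (RN_deriv M N)"
      using D by (intro density_cong) auto
    then show ?thesis using D M.density_RN_deriv[OF N(3,2)] by auto
  qed
  obtain p where p[measurable]: "p \<in> borel_measurable M" and p0: "\<And>x. 0 \<le> p x"
    and Pd: "density M (\<lambda>x. ennreal (p x)) = P" using dens[OF P] by blast
  obtain q where q[measurable]: "q \<in> borel_measurable M" and q0: "\<And>x. 0 \<le> q x"
    and Qd: "density M (\<lambda>x. ennreal (q x)) = Q" using dens[OF Q] by blast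
  have intp: "integrable M r"
    if "prob_space (density M (\<lambda>x. ennreal (r x)))" "\<And>x. 0 \<le> r x" "r \<in> borel_measurable M" for r
  proof -
    interpret R: prob_space "density M (\<lambda>x. ennreal (r x))" by fact
    have "(\<integral>\<^sup>+x. ennreal (r x) \<partial>M) = 1"
      using R.emeasure_space_1 that by (simp add: emeasure_density cong: nn_integral_cong)
    then show ?thesis using that by (intro integrableI_nonneg) auto
  qed
  have ip: "integrable M p" "integrable M q"
    using P Q p0 q0 Pd Qd by (auto intro!: intp)
  define u where "u x = max 0 (p x - q x)" for x
  define v where "v x = max 0 (q x - p x)" for x
  have [measurable]: "u \<in> borel_measurable M" "v \<in> borel_measurable M"
    unfolding u_def v_def by measurable
  have iuv: "integrable M u" "integrable M v"
    unfolding u_def v_def using ip by auto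
  have uv0: "0 \<le> u x" "0 \<le> v x" for x by (auto simp: u_def v_def)
  have uv_diff: "p x - q x = u x - v x" for x by (auto simp: u_def v_def)
  have intdens: "(\<integral>x. f x \<partial>density M (\<lambda>x. ennreal (r x))) = (\<integral>x. r x * f x \<partial>M)"
    if "r \<in> borel_measurable M" "\<And>x. 0 \<le> r x" "f \<in> borel_measurable M" for r and f :: "'a \<Rightarrow> real"
    using integral_density[of f M r] that by simp
  have int_mult: "integrable M (\<lambda>x. r x * f x)"
    if "integrable M r" "f \<in> borel_measurable M" "\<And>x. \<bar>f x\<bar> \<le> 1" for r f :: "'a \<Rightarrow> real"
    using that by (intro Bochner_Integration.integrable_bound[OF that(1)])
      (auto simp: abs_mult mult_left_le)
  have diff: "(\<integral>x. f x \<partial>P) - (\<integral>x. f x \<partial>Q) = (\<integral>x. u x * f x \<partial>M) - (\<integral>x. v x * f x \<partial>M)"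
    if f: "f \<in> borel_measurable M" "\<And>x. \<bar>f x\<bar> \<le> 1" for f
  proof -
    have "(\<integral>x. f x \<partial>P) - (\<integral>x. f x \<partial>Q) = (\<integral>x. p x * f x \<partial>M) - (\<integral>x. q x * f x \<partial>M)"
      unfolding Pd[symmetric] Qd[symmetric] using f p0 q0 by (simp add: intdens)
    also have "\<dots> = (\<integral>x. (p x - q x) * f x \<partial>M)"
      using f ip by (simp add: int_mult left_diff_distrib)
    also have "\<dots> = (\<integral>x. u x * f x \<partial>M) - (\<integral>x. v x * f x \<partial>M)"
      unfolding uv_diff using f iuv by (simp add: int_mult left_diff_distrib)
    finally show ?thesis .
  qed
  define s where "s = (\<integral>x. u x \<partial>M)"
  have s0: "0 \<le> s" unfolding s_def using uv0 by (intro integral_nonneg_AE) auto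
  \<comment> \<open>Testing the difference against the constant 1 shows that \<open>u\<close> and
    \<open>v\<close> have the same mass, as \<open>P\<close> and \<open>Q\<close> are both
    probability measures.\<close>
  have sv: "s = (\<integral>x. v x \<partial>M)"
    using diff[of "\<lambda>_. 1"] prob_space.prob_space[OF P(1)] prob_space.prob_space[OF Q(1)]
    by (simp add: s_def)
  \<comment> \<open>On this set \<open>v\<close> vanishes, and off it \<open>u\<close> vanishes, so
    it realises the mass \<open>s\<close> as a difference of probabilities.\<close>
  define B where "B = {x\<in>space M. q x < p x}"
  have B: "B \<in> sets M" unfolding B_def by measurable
  have "measure P B - measure Q B = (\<integral>x. u x * indicator B x \<partial>M) - (\<integral>x. v x * indicator B x \<partial>M)"
    using diff[of "indicator B"] B P(2) Q(2) by simp
  also have "(\<integral>x. u x * indicator B x \<partial>M) = s"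
    unfolding s_def by (intro Bochner_Integration.integral_cong) (auto simp: B_def u_def indicator_def)
  also have "(\<integral>x. v x * indicator B x \<partial>M) = (\<integral>x. 0 \<partial>M)"
    by (intro Bochner_Integration.integral_cong) (auto simp: B_def v_def indicator_def)
  finally have sB: "s = measure P B - measure Q B" by simp
  show ?thesis
  proof (cases "s = 0")
    case True
    then have "AE x in M. u x = 0" "AE x in M. v x = 0"
      using iuv uv0 s_def sv
      by (auto simp: integral_nonneg_eq_0_iff_AE[symmetric] simp del: AE_conj_iff)
    then have "(\<integral>x. u x * f x \<partial>M) = 0" "(\<integral>x. v x * f x \<partial>M) = 0" for f
      by (auto intro!: integral_eq_zero_AE)
    \<comment> \<open>For \<open>s = 0\<close> both sides vanish whatever the two probability
      measures are, so \<open>M\<close> is supplied for each.\<close>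
    then show ?thesis
      using that[OF s0 B sB M refl M refl] diff True by simp
  next
    case False
    then have s_pos: "0 < s" using s0 by simp
    define R where "R r = density M (\<lambda>x. ennreal (r x / s))" for r
    have R: "prob_space (R r)" "sets (R r) = sets M"
      "\<And>f::'a \<Rightarrow> real. f \<in> borel_measurable M \<Longrightarrow> (\<integral>x. f x \<partial>R r) = (\<integral>x. r x * f x \<partial>M) / s"
      if r: "r \<in> borel_measurable M" "integrable M r" "\<And>x. 0 \<le> r x" "(\<integral>x. r x \<partial>M) = s" for r
    proof -
      have "emeasure (R r) (space (R r)) = (\<integral>\<^sup>+x. ennreal (r x / s) \<partial>M)"
        using r by (simp add: R_def emeasure_density cong: nn_integral_cong)
      also have "\<dots> = ennreal (\<integral>x. r x / s \<partial>M)"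
        using r s0 by (intro nn_integral_eq_integral) auto
      also have "\<dots> = 1" using r s_pos by simp
      finally show "prob_space (R r)" by (rule prob_spaceI)
      show "sets (R r) = sets M" by (simp add: R_def)
      fix f :: "'a \<Rightarrow> real" assume f: "f \<in> borel_measurable M"
      have "(\<integral>x. f x \<partial>R r) = (\<integral>x. (r x / s) * f x \<partial>M)"
        unfolding R_def using r s0 f by (intro intdens) auto
      then show "(\<integral>x. f x \<partial>R r) = (\<integral>x. r x * f x \<partial>M) / s" by simp
    qed
    have Ru: "prob_space (R u)" "sets (R u) = sets M" and Rv: "prob_space (R v)" "sets (R v) = sets M"
      using iuv uv0 s_def sv by (simp_all add: R)
    show ?thesis
    proof (rule that[OF s0 B sB Ru Rv])
      fix f :: "'a \<Rightarrow> real" assume f: "f \<in> borel_measurable M" "\<And>x. \<bar>f x\<bar> \<le> 1"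
      have "(\<integral>x. f x \<partial>R u) = (\<integral>x. u x * f x \<partial>M) / s" "(\<integral>x. f x \<partial>R v) = (\<integral>x. v x * f x \<partial>M) / s"
        using R(3)[OF _ iuv(1) uv0(1) s_def[symmetric] f(1)] R(3)[OF _ iuv(2) uv0(2) sv[symmetric] f(1)]
        by simp_all
      then show "(\<integral>x. f x \<partial>P) - (\<integral>x. f x \<partial>Q) = s * ((\<integral>x. f x \<partial>R u) - (\<integral>x. f x \<partial>R v))"
        using diff[OF f] s_pos by (simp add: right_diff_distrib)
    qed
  qed
qed

text \<open>Under the independent coupling of \<open>P\<close> and \<open>Q\<close> both integrals
  become integrals over the product of functions of one coordinate, and the pointwise bound can be
  integrated.\<close>

lemma integral_diff_le_pair:
  fixes f :: "'a \<Rightarrow> real"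
  assumes P: "prob_space P" "sets P = sets N" and Q: "prob_space Q" "sets Q = sets N"
    and f[measurable]: "f \<in> borel_measurable N" "\<And>x. \<bar>f x\<bar> \<le> 1"
    and d[measurable]: "d \<in> borel_measurable (N \<Otimes>\<^sub>M N)" "\<And>z. \<bar>d z\<bar> \<le> 1"
    and fd: "\<And>x y. f x - f y \<le> d (x, y)"
  shows "(\<integral>x. f x \<partial>P) - (\<integral>x. f x \<partial>Q) \<le> (\<integral>z. d z \<partial>(P \<Otimes>\<^sub>M Q))"
proof -
  interpret P: prob_space P by fact
  interpret Q: prob_space Q by fact
  interpret PQ: pair_prob_space P Q ..
  note [measurable_cong] = P(2) Q(2)
  have int: "integrable (P \<Otimes>\<^sub>M Q) (\<lambda>z. f (fst z))" "integrable (P \<Otimes>\<^sub>M Q) (\<lambda>z. f (snd z))"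
    "integrable (P \<Otimes>\<^sub>M Q) d"
    using f(2) d(2) by (auto intro!: PQ.integrable_const_bound[where B=1])
  have "(\<integral>z. f (fst z) \<partial>(P \<Otimes>\<^sub>M Q)) = (\<integral>x. f x \<partial>P)"
    using PQ.integral_fst'[OF int(1)] by (simp add: Q.prob_space)
  moreover have "(\<integral>z. f (snd z) \<partial>(P \<Otimes>\<^sub>M Q)) = (\<integral>x. f x \<partial>Q)"
    using PQ.integral_fst'[OF int(2)] by (simp add: P.prob_space)
  moreover have "(\<integral>z. f (fst z) - f (snd z) \<partial>(P \<Otimes>\<^sub>M Q)) \<le> (\<integral>z. d z \<partial>(P \<Otimes>\<^sub>M Q))"
    using int fd by (intro integral_mono) auto
  ultimately show ?thesis using int by simp
qed

subsection \<open>Iterated kernels\<close>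

text \<open>Fubini reduces the claim to iterated almost-everywhere statements, in which the inner
  and the outer measure are exchanged one after the other.\<close>

lemma pair_measure_AE_cong:
  assumes "sigma_finite_measure M\<^sub>1" "sigma_finite_measure M\<^sub>2" "sigma_finite_measure N\<^sub>1" "sigma_finite_measure N\<^sub>2"
    and sets: "sets N\<^sub>1 = sets M\<^sub>1" "sets N\<^sub>2 = sets M\<^sub>2"
    and eq\<^sub>1: "\<And>P. Measurable.pred M\<^sub>1 P \<Longrightarrow> (AE x in N\<^sub>1. P x) \<longleftrightarrow> (AE x in M\<^sub>1. P x)"
    and eq\<^sub>2: "\<And>P. Measurable.pred M\<^sub>2 P \<Longrightarrow> (AE x in N\<^sub>2. P x) \<longleftrightarrow> (AE x in M\<^sub>2. P x)"
    and P[measurable]: "Measurable.pred (M\<^sub>1 \<Otimes>\<^sub>M M\<^sub>2) P"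
  shows "(AE z in N\<^sub>1 \<Otimes>\<^sub>M N\<^sub>2. P z) \<longleftrightarrow> (AE z in M\<^sub>1 \<Otimes>\<^sub>M M\<^sub>2. P z)"
proof -
  interpret M\<^sub>2: sigma_finite_measure M\<^sub>2 by fact
  interpret M: pair_sigma_finite M\<^sub>1 M\<^sub>2 using assms by (simp add: pair_sigma_finite_def)
  interpret N: pair_sigma_finite N\<^sub>1 N\<^sub>2 using assms by (simp add: pair_sigma_finite_def)
  note [measurable_cong] = sets
  have "(AE z in N\<^sub>1 \<Otimes>\<^sub>M N\<^sub>2. P z) \<longleftrightarrow> (AE x in N\<^sub>1. AE y in N\<^sub>2. P (x, y))"
    using N.AE_pair[of P] N.AE_pair_measure[of P] by auto
  also have "\<dots> \<longleftrightarrow> (AE x in N\<^sub>1. AE y in M\<^sub>2. P (x, y))"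
    using sets_eq_imp_space_eq[OF sets(1)] by (intro AE_cong eq\<^sub>2) auto
  also have "\<dots> \<longleftrightarrow> (AE x in M\<^sub>1. AE y in M\<^sub>2. P (x, y))"
  proof (rule eq\<^sub>1)
    \<comment> \<open>Exchanging the outer measure requires the inner statement to be measurable in
      \<open>x\<close>; it is rewritten as the vanishing of the \<open>M\<^sub>2\<close>-measure of
      a section.\<close>
    let ?A = "{z\<in>space (M\<^sub>1 \<Otimes>\<^sub>M M\<^sub>2). \<not> P z}"
    have "(AE y in M\<^sub>2. P (x, y)) \<longleftrightarrow> emeasure M\<^sub>2 (Pair x -` ?A) = 0" if "x \<in> space M\<^sub>1" for x
    proof (rule AE_iff_measurable)
      show "Pair x -` ?A \<in> sets M\<^sub>2" by (rule sets_Pair1) measurable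
      show "{y \<in> space M\<^sub>2. \<not> P (x, y)} = Pair x -` ?A"
        using that by (auto simp: space_pair_measure)
    qed
    moreover have "Measurable.pred M\<^sub>1 (\<lambda>x. emeasure M\<^sub>2 (Pair x -` ?A) = 0)"
      using M\<^sub>2.measurable_emeasure_Pair[of ?A M\<^sub>1] by measurable
    ultimately show "Measurable.pred M\<^sub>1 (\<lambda>x. AE y in M\<^sub>2. P (x, y))"
      by (simp cong: measurable_cong)
  qed
  also have "\<dots> \<longleftrightarrow> (AE z in M\<^sub>1 \<Otimes>\<^sub>M M\<^sub>2. P z)"
    using M.AE_pair[of P] M.AE_pair_measure[of P] by auto
  finally show ?thesis .
qed

section \<open>Composition of finite measures with kernels, and the iterates of a kernel\<close>

lemma measure_bind_finite:
  assumes M: "finite_measure M" and K: "K \<in> M \<rightarrow>\<^sub>M prob_algebra N" and A: "A \<in> sets N"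
    and ne: "space M \<noteq> {}"
  shows "measure (M \<bind> K) A = (\<integral>x. measure (K x) A \<partial>M)"
proof -
  have K': "prob_space (K x)" "sets (K x) = sets N" if "x \<in> space M" for x
    using measurable_space[OF K that] by (auto simp: space_prob_algebra)
  have "(\<integral>y. indicator A y \<partial>(M \<bind> K)) = (\<integral>x. (\<integral>y. (indicator A y :: real) \<partial>K x) \<partial>M)"
    using K K' A M by (intro integral_bind[where K=N and B=1 and B'=1])
      (auto intro: measurable_prob_algebraD simp: prob_space.emeasure_space_1 indicator_def)
  also have "\<dots> = (\<integral>x. measure (K x) A \<partial>M)"
    using K' A by (intro Bochner_Integration.integral_cong) (auto simp: sets.Int_space_eq2 dest!: sets.sets_into_space)
  finally show ?thesis
    using A ne sets_bind[OF K'(2) ne] by simp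
qed

lemma finite_measure_bind:
  assumes M: "finite_measure M" and K: "K \<in> M \<rightarrow>\<^sub>M prob_algebra N" and ne: "space M \<noteq> {}"
  shows "finite_measure (M \<bind> K)"
proof (rule finite_measureI)
  have K': "prob_space (K x)" "sets (K x) = sets N" if "x \<in> space M" for x
    using measurable_space[OF K that] by (auto simp: space_prob_algebra)
  have sp: "space (M \<bind> K) = space N"
    using sets_bind[OF K'(2) ne] by (rule sets_eq_imp_space_eq)
  have "emeasure (M \<bind> K) (space N) = (\<integral>\<^sup>+x. emeasure (K x) (space N) \<partial>M)"
    using K by (intro emeasure_bind[OF ne measurable_prob_algebraD]) auto
  also have "\<dots> = (\<integral>\<^sup>+x. 1 \<partial>M)"
    using K' by (intro nn_integral_cong) (metis prob_space.emeasure_space_1 sets_eq_imp_space_eq)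
  finally show "emeasure (M \<bind> K) (space (M \<bind> K)) \<noteq> \<infinity>"
    using finite_measure.emeasure_finite[OF M] by (simp add: sp)
qed

text \<open>The recursion splits off the first step of the chain, not the last. This is the form
  needed for conditioning on the first step, and it matches a power of the operator whose first
  application is carried out first.\<close>

primrec kernel_iter :: "('a::topological_space \<Rightarrow> 'a measure) \<Rightarrow> nat \<Rightarrow> 'a \<Rightarrow> 'a measure" where
  "kernel_iter k 0 = return borel"
| "kernel_iter k (Suc n) = (\<lambda>x. k x \<bind> kernel_iter k n)"

lemma measurable_kernel_iter:
  assumes "k \<in> borel \<rightarrow>\<^sub>M prob_algebra borel"
  shows "kernel_iter k n \<in> borel \<rightarrow>\<^sub>M prob_algebra borel"
  by (induction n) (auto intro!: measurable_return_prob_space measurable_bind_prob_space[OF assms])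

lemma bind_kernel_iter_Suc:
  assumes k: "k \<in> borel \<rightarrow>\<^sub>M prob_algebra borel" and M: "sets M = sets borel"
  shows "M \<bind> kernel_iter k (Suc n) = (M \<bind> k) \<bind> kernel_iter k n"
  unfolding kernel_iter.simps
proof (rule bind_assoc[symmetric])
  show "k \<in> M \<rightarrow>\<^sub>M subprob_algebra borel"
    using measurable_prob_algebraD[OF k] measurable_cong_sets[OF M refl] by blast
  show "kernel_iter k n \<in> borel \<rightarrow>\<^sub>M subprob_algebra borel"
    by (rule measurable_prob_algebraD[OF measurable_kernel_iter[OF k]])
qed

section \<open>Equivalent transition probabilities with an invariant probability measure\<close>

locale equivalent_kernel =
  fixes k :: "'a::polish_space \<Rightarrow> 'a measure" and M :: "'a measure"
  assumes kernel[measurable]: "k \<in> borel \<rightarrow>\<^sub>M prob_algebra borel"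
    and equivalent: "\<And>x y A. A \<in> sets borel \<Longrightarrow> emeasure (k x) A = 0 \<longleftrightarrow> emeasure (k y) A = 0"
    and prob_M: "prob_space M" and sets_M[measurable_cong]: "sets M = sets borel"
    and invariant: "M \<bind> k = M"
begin

sublocale M: prob_space M by (rule prob_M)

lemma space_M: "space M = UNIV"
  using sets_eq_imp_space_eq[OF sets_M] by simp

lemma prob_k: "prob_space (k x)" and sets_k: "sets (k x) = sets borel"
  using measurable_space[OF kernel, of x] by (auto simp: space_prob_algebra)

lemma prob_iter: "prob_space (kernel_iter k n x)"
  and sets_iter: "sets (kernel_iter k n x) = sets borel"
  using measurable_space[OF measurable_kernel_iter[OF kernel], of x n] by (auto simp: space_prob_algebra)

lemma measurable_measure_iter [measurable]:
  "A \<in> sets borel \<Longrightarrow> (\<lambda>x. measure (kernel_iter k n x) A) \<in> borel_measurable borel"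
  by (rule measurable_compose[OF measurable_kernel_iter[OF kernel] measurable_measure_prob_algebra])

lemma invariant_iter: "M \<bind> kernel_iter k n = M"
proof (induction n)
  case 0
  then show ?case by (simp add: bind_return'' sets_M)
next
  case (Suc n)
  then show ?case by (simp add: bind_kernel_iter_Suc[OF kernel sets_M] invariant del: kernel_iter.simps)
qed

text \<open>By invariance, a property holds almost everywhere for \<open>M\<close> iff for
  \<open>M\<close>-almost every \<open>y\<close> it holds almost everywhere for \<open>k y\<close>.
  The inner statement does not depend on \<open>y\<close>, so it may be taken at \<open>x\<close>,
  and the outer quantifier over a probability measure disappears.\<close>

lemma AE_k_iff:
  assumes P[measurable]: "Measurable.pred borel P"
  shows "(AE u in k x. P u) \<longleftrightarrow> (AE u in M. P u)"
proof -
  have iff: "(AE u in k y. P u) \<longleftrightarrow> emeasure (k y) {u. \<not> P u} = 0" for y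
    using sets_eq_imp_space_eq[OF sets_k[of y]] sets_k[of y]
    by (intro AE_iff_measurable) auto
  have "(AE u in M. P u) \<longleftrightarrow> (AE u in M \<bind> k. P u)" unfolding invariant by (rule refl)
  also have "\<dots> \<longleftrightarrow> (AE y in M. AE u in k y. P u)"
    using measurable_prob_algebraD[OF kernel] by (intro AE_bind[where B=borel]) auto
  also have "\<dots> \<longleftrightarrow> (AE y in M. AE u in k x. P u)"
  proof (rule AE_cong)
    show "(AE u in k y. P u) \<longleftrightarrow> (AE u in k x. P u)" for y
      unfolding iff by (rule equivalent) simp
  qed
  finally show ?thesis by simp
qed

lemma absolutely_continuous_k: "absolutely_continuous M (k x)"
  unfolding absolutely_continuous_def
proof
  fix A assume A: "A \<in> null_sets M"
  then have [measurable]: "A \<in> sets borel" by (auto simp: null_sets_def sets_M)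
  have "AE u in M. u \<notin> A" using A by (rule AE_not_in)
  then have "AE u in k x. u \<notin> A" by (subst AE_k_iff) auto
  then show "A \<in> null_sets (k x)"
    by (subst AE_iff_null_sets) (auto simp: sets_k)
qed

section \<open>The product kernel and the vanishing distance between iterates\<close>

definition pair_kernel :: "'a \<times> 'a \<Rightarrow> ('a \<times> 'a) measure" where
  "pair_kernel z = k (fst z) \<Otimes>\<^sub>M k (snd z)"

lemma pair_kernel [measurable]: "pair_kernel \<in> borel \<Otimes>\<^sub>M borel \<rightarrow>\<^sub>M prob_algebra (borel \<Otimes>\<^sub>M borel)"
  unfolding pair_kernel_def by measurable

lemma AE_pair_kernel_iff:
  assumes "Measurable.pred (borel \<Otimes>\<^sub>M borel) P"
  shows "(AE w in pair_kernel z. P w) \<longleftrightarrow> (AE w in M \<Otimes>\<^sub>M M. P w)"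
  unfolding pair_kernel_def
proof (rule pair_measure_AE_cong)
  show "Measurable.pred (M \<Otimes>\<^sub>M M) P" using assms by simp
qed (auto simp: sets_k sets_M AE_k_iff prob_k intro!: prob_space_imp_sigma_finite M.sigma_finite_measure_axioms cong: measurable_cong_sets)

text \<open>Equality is tested on rectangles, where the integrand factors into one function of each
  coordinate and the invariance of \<open>M\<close> applies to each factor.\<close>

lemma pair_invariant: "(M \<Otimes>\<^sub>M M) \<bind> pair_kernel = M \<Otimes>\<^sub>M M"
proof (rule pair_measure_eqI[symmetric])
  interpret MM: pair_prob_space M M ..
  have ne: "space (M \<Otimes>\<^sub>M M) \<noteq> {}" by (simp add: space_pair_measure space_M)
  have q: "pair_kernel \<in> M \<Otimes>\<^sub>M M \<rightarrow>\<^sub>M subprob_algebra (borel \<Otimes>\<^sub>M borel)"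
    using measurable_prob_algebraD[OF pair_kernel] by measurable
  show "sigma_finite_measure M" "sigma_finite_measure M" by unfold_locales
  show "sets (M \<Otimes>\<^sub>M M) = sets ((M \<Otimes>\<^sub>M M) \<bind> pair_kernel)"
    using sets_bind[OF sets_kernel[OF q] ne] by (simp add: sets_M cong: sets_pair_measure_cong)
  fix A B assume "A \<in> sets M" "B \<in> sets M"
  then have [measurable]: "A \<in> sets borel" "B \<in> sets borel" by (simp_all add: sets_M)
  have emb: "emeasure M A = (\<integral>\<^sup>+x. emeasure (k x) A \<partial>M)" if "A \<in> sets borel" for A
    using emeasure_bind[of M k borel A] that measurable_prob_algebraD[OF kernel]
    by (simp add: invariant space_M)
  have [measurable]: "(\<lambda>x. emeasure (k x) A) \<in> borel_measurable borel" if "A \<in> sets borel" for A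
    by (rule measurable_compose[OF measurable_prob_algebraD[OF kernel] measurable_emeasure_subprob_algebra[OF that]])
  have "emeasure ((M \<Otimes>\<^sub>M M) \<bind> pair_kernel) (A \<times> B) = (\<integral>\<^sup>+z. emeasure (pair_kernel z) (A \<times> B) \<partial>(M \<Otimes>\<^sub>M M))"
    by (rule emeasure_bind[OF ne q]) simp
  also have "\<dots> = (\<integral>\<^sup>+z. emeasure (k (fst z)) A * emeasure (k (snd z)) B \<partial>(M \<Otimes>\<^sub>M M))"
    unfolding pair_kernel_def
    by (intro nn_integral_cong sigma_finite_measure.emeasure_pair_measure_Times prob_space_imp_sigma_finite prob_k)
      (auto simp: sets_k)
  also have "\<dots> = (\<integral>\<^sup>+x. \<integral>\<^sup>+y. emeasure (k x) A * emeasure (k y) B \<partial>M \<partial>M)"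
    by (subst M.nn_integral_fst[symmetric]) (auto simp: case_prod_beta)
  also have "\<dots> = emeasure M A * emeasure M B"
    by (simp add: nn_integral_cmult nn_integral_multc emb)
  finally show "emeasure M A * emeasure M B = emeasure ((M \<Otimes>\<^sub>M M) \<bind> pair_kernel) (A \<times> B)" ..
qed

text \<open>The conclusion is shaped for dominated convergence: measurable functions with values in
  the unit interval that dominate the distance uniformly in \<open>A\<close> and tend to zero
  pointwise.\<close>

lemma iter_distance_vanishes:
  obtains D :: "nat \<Rightarrow> 'a \<times> 'a \<Rightarrow> real"
  where "\<And>n. D n \<in> borel_measurable (borel \<Otimes>\<^sub>M borel)" "\<And>n z. 0 \<le> D n z" "\<And>n z. D n z \<le> 1"
    "\<And>n x y A. A \<in> sets borel \<Longrightarrow>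
      \<bar>measure (kernel_iter k n x) A - measure (kernel_iter k n y) A\<bar> \<le> D n (x, y)"
    "\<And>z. (\<lambda>n. D n z) \<longlonglongrightarrow> 0"
proof -
  obtain \<C> :: "'a set set" where \<C>: "countable \<C>" "\<C> \<subseteq> sets borel" "\<C> \<noteq> {}"
    and det: "\<And>P Q c A. finite_measure P \<Longrightarrow> sets P = sets borel \<Longrightarrow> finite_measure Q \<Longrightarrow> sets Q = sets borel \<Longrightarrow>
      (\<And>B. B \<in> \<C> \<Longrightarrow> \<bar>measure P B - measure Q B\<bar> \<le> c) \<Longrightarrow> A \<in> sets borel \<Longrightarrow>
      \<bar>measure P A - measure Q A\<bar> \<le> c"
    using countable_class_determining_distance by blast
  define \<delta> where "\<delta> j A z = \<bar>measure (kernel_iter k j (fst z)) A - measure (kernel_iter k j (snd z)) A\<bar>" for j A z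
  have \<delta>01: "0 \<le> \<delta> j A z" "\<delta> j A z \<le> 1" for j A z
    using prob_space.prob_le_1[OF prob_iter, of j "fst z" A] prob_space.prob_le_1[OF prob_iter, of j "snd z" A]
      measure_nonneg[of "kernel_iter k j (fst z)" A] measure_nonneg[of "kernel_iter k j (snd z)" A]
    unfolding \<delta>_def by linarith+
  have \<delta>_meas: "\<delta> j A \<in> borel_measurable (borel \<Otimes>\<^sub>M borel)" if [measurable]: "A \<in> sets borel" for j A
    unfolding \<delta>_def by measurable
  \<comment> \<open>Taking all \<open>j \<ge> n\<close> makes the sequence decreasing, so that it
    has a limit; restricting to the countable class makes it measurable. By the choice of \<C>, the
    resulting bound still holds for every Borel set (\<open>upper\<close>).\<close>
  define D where "D n z = (SUP i\<in>{n..} \<times> \<C>. \<delta> (fst i) (snd i) z)" for n z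
  have bdd: "bdd_above ((\<lambda>i. \<delta> (fst i) (snd i) z) ` I)" for z I
    by (rule bdd_aboveI[where M=1]) (auto intro: \<delta>01(2))
  have least: "D n z \<le> c" if "\<And>j A. n \<le> j \<Longrightarrow> A \<in> \<C> \<Longrightarrow> \<delta> j A z \<le> c" for n z c
    unfolding D_def using \<C>(3) that by (intro cSUP_least) auto
  have upper: "\<delta> j A z \<le> D n z" if "n \<le> j" "A \<in> sets borel" for n j A z
    unfolding \<delta>_def
  proof (rule det)
    fix B assume "B \<in> \<C>"
    then show "\<bar>measure (kernel_iter k j (fst z)) B - measure (kernel_iter k j (snd z)) B\<bar> \<le> D n z"
      unfolding D_def using \<open>n \<le> j\<close> cSUP_upper[OF _ bdd, of "(j, B)" "{n..} \<times> \<C>" z]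
      by (simp add: \<delta>_def)
  qed (use that in \<open>auto simp: sets_iter prob_space.finite_measure prob_iter\<close>)
  have D01: "0 \<le> D n z" "D n z \<le> 1" for n z
    using upper[of n n "{}" z] \<delta>01(1)[of n "{}" z] least[of n z 1] \<delta>01(2) by auto
  have D_meas[measurable]: "D n \<in> borel_measurable (borel \<Otimes>\<^sub>M borel)" for n
    unfolding D_def using \<C> bdd
    by (intro borel_measurable_cSUP) (auto intro!: \<delta>_meas)
  have D_dec: "decseq (\<lambda>n. D n z)" for z
    unfolding D_def using \<C>(3) bdd by (intro decseq_SucI cSUP_subset_mono) auto
  define h where "h z = (INF n. D n z)" for z
  have D_lim: "(\<lambda>n. D n z) \<longlonglongrightarrow> h z" for z
    unfolding h_def by (rule LIMSEQ_decseq_INF[OF _ D_dec]) (auto intro!: bdd_belowI[where m=0] D01)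
  have h_meas[measurable]: "h \<in> borel_measurable (borel \<Otimes>\<^sub>M borel)"
    using D_lim D_meas by (rule borel_measurable_LIMSEQ_real)
  have h01: "0 \<le> h z" "h z \<le> 1" for z
    by (rule LIMSEQ_le_const[OF D_lim] LIMSEQ_le_const2[OF D_lim]; simp add: D01)+
  have int_lim: "(\<lambda>n. \<integral>z. D n z \<partial>N) \<longlonglongrightarrow> (\<integral>z. h z \<partial>N)"
    if "prob_space N" "sets N = sets (borel \<Otimes>\<^sub>M borel)" for N
  proof (rule integral_dominated_convergence[where w="\<lambda>_. 1"])
    interpret N: prob_space N by fact
    note [measurable_cong] = that(2)
    show "h \<in> borel_measurable N" "D n \<in> borel_measurable N" for n by measurable
    show "integrable N (\<lambda>_. 1 :: real)" by simp
  qed (auto simp: D01 D_lim)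
  have int_h: "integrable N h" if "prob_space N" "sets N = sets (borel \<Otimes>\<^sub>M borel)" for N
  proof -
    interpret N: prob_space N by fact
    note [measurable_cong] = that(2)
    show ?thesis by (rule N.integrable_const_bound[where B=1]) (auto simp: h01)
  qed
  have iter_Suc: "measure (kernel_iter k (Suc j) x) A = (\<integral>u. measure (kernel_iter k j u) A \<partial>k x)"
    if "A \<in> sets borel" for j x A
    unfolding kernel_iter.simps
  proof (rule measure_bind_finite[where N=borel])
    show "kernel_iter k j \<in> k x \<rightarrow>\<^sub>M prob_algebra borel"
      using measurable_kernel_iter[OF kernel] measurable_cong_sets[OF sets_k refl] by blast
    show "finite_measure (k x)" by (rule prob_space.finite_measure[OF prob_k])
    show "space (k x) \<noteq> {}" by (rule prob_space.not_empty[OF prob_k])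
  qed fact
  have pair_le: "\<bar>(\<integral>u. measure (kernel_iter k j u) A \<partial>P) - (\<integral>u. measure (kernel_iter k j u) A \<partial>Q)\<bar>
      \<le> (\<integral>z. D n z \<partial>(P \<Otimes>\<^sub>M Q))"
    if "n \<le> j" and A[measurable]: "A \<in> sets borel"
      and P: "prob_space P" "sets P = sets borel" and Q: "prob_space Q" "sets Q = sets borel" for n j A P Q
  proof -
    let ?f = "\<lambda>u. measure (kernel_iter k j u) A"
    have d: "\<bar>?f u - ?f v\<bar> \<le> D n (u, v)" for u v
      using upper[OF \<open>n \<le> j\<close> A, of "(u, v)"] by (simp add: \<delta>_def)
    have f1: "\<bar>?f u\<bar> \<le> 1" for u using prob_space.prob_le_1[OF prob_iter] by simp
    have D1: "\<bar>D n z\<bar> \<le> 1" for z using D01[of n z] by simp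
    have "(\<integral>u. ?f u \<partial>P) - (\<integral>u. ?f u \<partial>Q) \<le> (\<integral>z. D n z \<partial>(P \<Otimes>\<^sub>M Q))"
    proof (rule integral_diff_le_pair[OF P Q _ f1 D_meas D1])
      show "?f u - ?f v \<le> D n (u, v)" for u v using d[of u v] by linarith
    qed measurable
    \<comment> \<open>A second application, to the negated function, supplies the other half of the
      absolute value.\<close>
    moreover have "(\<integral>u. - ?f u \<partial>P) - (\<integral>u. - ?f u \<partial>Q) \<le> (\<integral>z. D n z \<partial>(P \<Otimes>\<^sub>M Q))"
    proof (rule integral_diff_le_pair[OF P Q _ _ D_meas D1])
      show "- ?f u - - ?f v \<le> D n (u, v)" for u v using d[of u v] by linarith
      show "\<bar>- ?f u\<bar> \<le> 1" for u using f1 by simp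
    qed measurable
    ultimately show ?thesis by (simp add: abs_le_iff)
  qed
  have pair_sets: "sets (P \<Otimes>\<^sub>M Q) = sets (borel \<Otimes>\<^sub>M borel)"
    if "sets P = sets (borel :: 'a measure)" "sets Q = sets (borel :: 'a measure)" for P Q
    using that by (rule sets_pair_measure_cong)
  have sub: "h z \<le> (\<integral>w. h w \<partial>pair_kernel z)" for z
  proof (rule LIMSEQ_le)
    show "(\<lambda>n. D (Suc n) z) \<longlonglongrightarrow> h z" using D_lim by (rule LIMSEQ_Suc)
    show "(\<lambda>n. \<integral>w. D n w \<partial>pair_kernel z) \<longlonglongrightarrow> (\<integral>w. h w \<partial>pair_kernel z)"
      unfolding pair_kernel_def by (intro int_lim prob_space_pair prob_k pair_sets sets_k)
    \<comment> \<open>Conditioning on the first step uses up one unit of time: each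
      \<open>j \<ge> Suc n\<close> is the successor of some \<open>i \<ge> n\<close>, hence the
      shift of index between the two sides. The shift disappears in the limit.\<close>
    have "D (Suc n) z \<le> (\<integral>w. D n w \<partial>pair_kernel z)" for n
    proof (rule least)
      fix j A assume "Suc n \<le> j" "A \<in> \<C>"
      then obtain i where "j = Suc i" "n \<le> i" by (cases j) auto
      then show "\<delta> j A z \<le> (\<integral>w. D n w \<partial>pair_kernel z)"
        using \<open>A \<in> \<C>\<close> \<C>(2) pair_le[OF \<open>n \<le> i\<close> _ prob_k sets_k prob_k sets_k, of A "fst z" "snd z"]
        by (auto simp: \<delta>_def iter_Suc pair_kernel_def simp del: kernel_iter.simps)
    qed
    then show "\<exists>N. \<forall>n\<ge>N. D (Suc n) z \<le> (\<integral>w. D n w \<partial>pair_kernel z)" by blast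
  qed
  define m where "m = (\<integral>w. h w \<partial>(M \<Otimes>\<^sub>M M))"
  have MM: "prob_space (M \<Otimes>\<^sub>M M)" "sets (M \<Otimes>\<^sub>M M) = sets (borel \<Otimes>\<^sub>M borel)"
    by (auto intro!: prob_space_pair prob_M pair_sets sets_M)
  have h_le: "h z \<le> m" for z
    unfolding m_def
    by (rule subharmonic_le_mean[OF pair_kernel MM pair_invariant AE_pair_kernel_iff h_meas h01 sub])
      (auto simp: space_pair_measure)
  \<comment> \<open>Being nowhere above its mean, \<open>h\<close> must attain it; otherwise it
    would be strictly below everywhere, and so would its mean.\<close>
  obtain z where z: "h z = m"
  proof (rule ccontr)
    assume "\<not> thesis"
    then have "h z \<noteq> m" for z using that by blast
    then have "h z < m" for z using h_le[of z] by (simp add: less_le)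
    then have "(\<integral>w. h w \<partial>(M \<Otimes>\<^sub>M M)) < m"
      by (intro prob_space.expectation_less MM int_h) auto
    then show False by (simp add: m_def)
  qed
  obtain x y where xy: "z = (x, y)" by (cases z)
  obtain s R\<^sub>1 R\<^sub>2 B where s: "0 \<le> s" "B \<in> sets borel" "s = measure (k x) B - measure (k y) B"
    and R: "prob_space R\<^sub>1" "sets R\<^sub>1 = sets borel" "prob_space R\<^sub>2" "sets R\<^sub>2 = sets borel"
    and diff: "\<And>f::'a \<Rightarrow> real. f \<in> borel_measurable borel \<Longrightarrow> (\<And>x. \<bar>f x\<bar> \<le> 1) \<Longrightarrow>
      (\<integral>x. f x \<partial>k x) - (\<integral>x. f x \<partial>k y) = s * ((\<integral>x. f x \<partial>R\<^sub>1) - (\<integral>x. f x \<partial>R\<^sub>2))"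
  proof -
    have "measurable M borel = (measurable borel borel :: ('a \<Rightarrow> real) set)"
      by (rule measurable_cong_sets[OF sets_M refl])
    then show ?thesis
      using prob_density_difference[OF prob_M prob_k _ absolutely_continuous_k prob_k _ absolutely_continuous_k, of x y thesis]
        that by (simp add: sets_M sets_k)
  qed
  \<comment> \<open>A difference of two probabilities can reach 1 only if \<open>B\<close> is null
    for \<open>k y\<close> and has positive measure for \<open>k x\<close>, which equivalence
    forbids.\<close>
  have "s < 1"
  proof (rule ccontr)
    assume "\<not> s < 1"
    moreover have "measure (k x) B \<le> 1" by (rule prob_space.prob_le_1[OF prob_k])
    ultimately have "measure (k x) B > 0" "measure (k y) B = 0"
      using s(3) measure_nonneg[of "k y" B] by linarith+
    moreover have "emeasure (k w) B = ennreal (measure (k w) B)" for w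
      by (rule finite_measure.emeasure_eq_measure[OF prob_space.finite_measure[OF prob_k]])
    ultimately show False using equivalent[OF s(2), of x y] by simp
  qed
  \<comment> \<open>The first-step estimate is repeated, but the difference of the integrals against
    \<open>k x\<close> and \<open>k y\<close> is first replaced by \<open>s\<close> times the one
    against \<open>R\<^sub>1\<close> and \<open>R\<^sub>2\<close>. The gain is the factor
    \<open>s\<close>.\<close>
  have "h z \<le> s * (\<integral>w. h w \<partial>(R\<^sub>1 \<Otimes>\<^sub>M R\<^sub>2))"
  proof (rule LIMSEQ_le)
    show "(\<lambda>n. D (Suc n) z) \<longlonglongrightarrow> h z" using D_lim by (rule LIMSEQ_Suc)
    show "(\<lambda>n. s * (\<integral>w. D n w \<partial>(R\<^sub>1 \<Otimes>\<^sub>M R\<^sub>2))) \<longlonglongrightarrow> s * (\<integral>w. h w \<partial>(R\<^sub>1 \<Otimes>\<^sub>M R\<^sub>2))"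
      by (intro tendsto_mult_left int_lim prob_space_pair pair_sets R)
    have "D (Suc n) z \<le> s * (\<integral>w. D n w \<partial>(R\<^sub>1 \<Otimes>\<^sub>M R\<^sub>2))" for n
    proof (rule least)
      fix j A assume "Suc n \<le> j" "A \<in> \<C>"
      then obtain i where i: "j = Suc i" "n \<le> i" by (cases j) auto
      have A: "A \<in> sets borel" using \<open>A \<in> \<C>\<close> \<C>(2) by auto
      let ?f = "\<lambda>u. measure (kernel_iter k i u) A"
      have "\<delta> j A z = \<bar>(\<integral>u. ?f u \<partial>k x) - (\<integral>u. ?f u \<partial>k y)\<bar>"
        using A by (simp add: \<delta>_def i xy iter_Suc del: kernel_iter.simps)
      also have "(\<integral>u. ?f u \<partial>k x) - (\<integral>u. ?f u \<partial>k y) = s * ((\<integral>u. ?f u \<partial>R\<^sub>1) - (\<integral>u. ?f u \<partial>R\<^sub>2))"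
        using prob_space.prob_le_1[OF prob_iter] A by (intro diff) auto
      also have "\<bar>\<dots>\<bar> = s * \<bar>(\<integral>u. ?f u \<partial>R\<^sub>1) - (\<integral>u. ?f u \<partial>R\<^sub>2)\<bar>"
        using s(1) by (simp add: abs_mult)
      also have "\<dots> \<le> s * (\<integral>w. D n w \<partial>(R\<^sub>1 \<Otimes>\<^sub>M R\<^sub>2))"
        using s(1) pair_le[OF i(2) A R] by (intro mult_left_mono)
      finally show "\<delta> j A z \<le> s * (\<integral>w. D n w \<partial>(R\<^sub>1 \<Otimes>\<^sub>M R\<^sub>2))" .
    qed
    then show "\<exists>N. \<forall>n\<ge>N. D (Suc n) z \<le> s * (\<integral>w. D n w \<partial>(R\<^sub>1 \<Otimes>\<^sub>M R\<^sub>2))" by blast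
  qed
  also have "\<dots> \<le> s * m"
  proof -
    have RR: "prob_space (R\<^sub>1 \<Otimes>\<^sub>M R\<^sub>2)" by (intro prob_space_pair R)
    have "(\<integral>w. h w \<partial>(R\<^sub>1 \<Otimes>\<^sub>M R\<^sub>2)) \<le> m"
      by (intro prob_space.integral_le_const[OF RR] int_h RR pair_sets R) (simp add: h_le)
    then show ?thesis using s(1) by (rule mult_left_mono)
  qed
  finally have "m * (1 - s) \<le> 0" by (simp add: z algebra_simps)
  then have "m \<le> 0" using \<open>s < 1\<close> by (simp add: mult_le_0_iff)
  then have "h z = 0" for z using h_le[of z] h01(1)[of z] by linarith
  then have "(\<lambda>n. D n z) \<longlonglongrightarrow> 0" for z using D_lim[of z] by simp
  moreover have "\<bar>measure (kernel_iter k n x) A - measure (kernel_iter k n y) A\<bar> \<le> D n (x, y)"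
    if "A \<in> sets borel" for n x y A
    using upper[OF order_refl that, of n "(x, y)"] by (simp add: \<delta>_def)
  ultimately show ?thesis using that[of D] D_meas D01 by blast
qed

end

section \<open>Powers of the operator on differences of finite measures\<close>

lemma signed_measure_diff_measures:
  assumes P: "finite_measure P" "sets P = sets borel" and N: "finite_measure N" "sets N = sets borel"
    and eq: "\<And>A. A \<in> sets borel \<Longrightarrow> \<nu> A = measure P A - measure N A"
  shows "signed_measure \<nu>"
  unfolding signed_measure_def
proof (intro conjI allI impI)
  show "\<nu> {} = 0" by (simp add: eq)
  fix A :: "nat \<Rightarrow> 'a set" assume A: "range A \<subseteq> sets borel" "disjoint_family A"
  have "(\<lambda>n. measure P (A n) - measure N (A n)) sums (measure P (\<Union>n. A n) - measure N (\<Union>n. A n))"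
    using A P N by (intro sums_diff finite_measure.finite_measure_UNION) auto
  moreover have "\<nu> (A n) = measure P (A n) - measure N (A n)" for n using A(1) by (intro eq) auto
  moreover have "\<nu> (\<Union>n. A n) = measure P (\<Union>n. A n) - measure N (\<Union>n. A n)"
    using A(1) by (intro eq sets.countable_UN) auto
  ultimately show "(\<lambda>n. \<nu> (A n)) sums \<nu> (\<Union>n. A n)" by simp
qed

lemma bind_kernel_borel:
  fixes K :: "'a::topological_space \<Rightarrow> 'a measure"
  assumes K: "K \<in> borel \<rightarrow>\<^sub>M prob_algebra borel" and P: "finite_measure P" "sets P = sets borel"
  shows "finite_measure (P \<bind> K)" "sets (P \<bind> K) = sets borel"
    "A \<in> sets borel \<Longrightarrow> measure (P \<bind> K) A = (\<integral>x. measure (K x) A \<partial>P)"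
proof -
  have ne: "space P \<noteq> {}" using sets_eq_imp_space_eq[OF P(2)] by simp
  have K': "K \<in> P \<rightarrow>\<^sub>M prob_algebra borel"
    using K measurable_cong_sets[OF P(2) refl] by blast
  show "finite_measure (P \<bind> K)" by (rule finite_measure_bind[OF P(1) K' ne])
  show "sets (P \<bind> K) = sets borel"
    using sets_bind[OF sets_kernel[OF measurable_prob_algebraD[OF K']] ne] by simp
  show "A \<in> sets borel \<Longrightarrow> measure (P \<bind> K) A = (\<integral>x. measure (K x) A \<partial>P)"
    by (rule measure_bind_finite[OF P(1) K' _ ne])
qed

text \<open>By \<open>signed_integral_eq\<close> the operator may be evaluated on any decomposition
  of \<nu>, and on each part it acts as composition with the kernel.\<close>

lemma kernel_op_eq:
  assumes k: "k \<in> borel \<rightarrow>\<^sub>M prob_algebra borel"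
    and P: "finite_measure P" "sets P = sets borel" and N: "finite_measure N" "sets N = sets borel"
    and eq: "\<And>A. A \<in> sets borel \<Longrightarrow> \<nu> A = measure P A - measure N A" and A: "A \<in> sets borel"
  shows "kernel_op k \<nu> A = measure (P \<bind> k) A - measure (N \<bind> k) A"
proof -
  have "kernel_op k \<nu> A = (\<integral>x. measure (k x) A \<partial>P) - (\<integral>x. measure (k x) A \<partial>N)"
    unfolding kernel_op_def
  proof (rule signed_integral_eq[OF signed_measure_diff_measures[OF P N eq] P N eq])
    show "(\<lambda>x. measure (k x) A) \<in> borel_measurable borel"
      by (rule measurable_compose[OF k measurable_measure_prob_algebra[OF A]])
    show "measure (k x) A \<le> 1" for x
      using measurable_space[OF k, of x] by (simp add: space_prob_algebra prob_space.prob_le_1)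
  qed simp_all
  then show ?thesis
    by (simp add: bind_kernel_borel(3)[OF k P A] bind_kernel_borel(3)[OF k N A])
qed

text \<open>The induction varies \<nu> together with its decomposition: after one application the
  parts are \<open>P \<bind> k\<close> and \<open>N \<bind> k\<close>, which need not be Jordan
  parts even if \<open>P\<close> and \<open>N\<close> are.\<close>

lemma kernel_op_funpow_eq:
  assumes k: "k \<in> borel \<rightarrow>\<^sub>M prob_algebra borel"
    and "finite_measure P" "sets P = sets borel" "finite_measure N" "sets N = sets borel"
    and "\<And>A. A \<in> sets borel \<Longrightarrow> \<nu> A = measure P A - measure N A" and A: "A \<in> sets borel"
  shows "(kernel_op k ^^ n) \<nu> A = measure (P \<bind> kernel_iter k n) A - measure (N \<bind> kernel_iter k n) A"
  using assms(2-6)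
proof (induction n arbitrary: \<nu> P N)
  case 0
  then show ?case using A by (simp add: bind_return'')
next
  case (Suc n)
  note P = Suc.prems(1,2) and N = Suc.prems(3,4) and eq = Suc.prems(5)
  have "(kernel_op k ^^ n) (kernel_op k \<nu>) A
      = measure ((P \<bind> k) \<bind> kernel_iter k n) A - measure ((N \<bind> k) \<bind> kernel_iter k n) A"
    by (rule Suc.IH[OF bind_kernel_borel(1,2)[OF k P] bind_kernel_borel(1,2)[OF k N] kernel_op_eq[OF k P N eq]])
  then show ?case
    by (simp add: funpow_Suc_right bind_kernel_iter_Suc[OF k P(2)] bind_kernel_iter_Suc[OF k N(2)]
        del: funpow.simps kernel_iter.simps)
qed

section \<open>Convergence of the powers in total variation\<close>

context equivalent_kernel
begin

text \<open>Averaging \<open>D n (x, y)\<close> over \<open>y\<close> against \<open>M\<close>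
  bounds the distance from the law after \<open>n\<close> steps to \<open>M\<close>. Integrating
  this bound over \<open>x\<close> against \<open>P\<close> and \<open>N\<close> gives an estimate
  uniform in the Borel set, which controls the norm and vanishes by dominated convergence.\<close>

lemma kernel_op_funpow_tendsto:
  assumes P: "finite_measure P" "sets P = sets borel" and N: "finite_measure N" "sets N = sets borel"
    and eq: "\<And>A. A \<in> sets borel \<Longrightarrow> \<nu> A = measure P A - measure N A"
    and \<mu>: "\<And>A. A \<in> sets borel \<Longrightarrow> \<mu> A = measure M A"
  shows "(\<lambda>n. tv_norm (\<lambda>A. (kernel_op k ^^ n) \<nu> A - \<nu> UNIV * \<mu> A)) \<longlonglongrightarrow> 0"
proof -
  obtain D where D_meas[measurable]: "\<And>n. D n \<in> borel_measurable (borel \<Otimes>\<^sub>M borel)"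
    and D01: "\<And>n z. 0 \<le> D n z" "\<And>n z. D n z \<le> 1"
    and D_ge: "\<And>n x y A. A \<in> sets borel \<Longrightarrow>
      \<bar>measure (kernel_iter k n x) A - measure (kernel_iter k n y) A\<bar> \<le> D n (x, y)"
    and D_lim: "\<And>z. (\<lambda>n. D n z) \<longlonglongrightarrow> 0"
    using iter_distance_vanishes by blast
  define E where "E n x = (\<integral>y. D n (x, y) \<partial>M)" for n x
  have int_D: "integrable M (\<lambda>y. D n (x, y))" for n x
    by (rule M.integrable_const_bound[where B=1]) (auto simp: D01)
  have E01: "0 \<le> E n x" "E n x \<le> 1" for n x
    unfolding E_def using int_D by (auto intro!: integral_nonneg_AE M.integral_le_const D01)
  have [measurable]: "E n \<in> borel_measurable borel" for n
    unfolding E_def by measurable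
  have E_lim: "(\<lambda>n. E n x) \<longlonglongrightarrow> 0" for x
  proof -
    have "(\<lambda>n. E n x) \<longlonglongrightarrow> (\<integral>y. 0 \<partial>M)"
      unfolding E_def by (rule integral_dominated_convergence[where w="\<lambda>_. 1"]) (auto simp: D01 D_lim)
    then show ?thesis by simp
  qed
  have M_iter: "measure M A = (\<integral>y. measure (kernel_iter k n y) A \<partial>M)" if "A \<in> sets borel" for n A
    using bind_kernel_borel(3)[OF measurable_kernel_iter[OF kernel] M.finite_measure_axioms sets_M that, of n]
    by (simp add: invariant_iter)
  have iter_int: "integrable R (\<lambda>y. measure (kernel_iter k n y) A)"
    if "finite_measure R" "sets R = sets borel" "A \<in> sets borel" for R n A
  proof -
    interpret R: finite_measure R by fact
    note [measurable_cong] = that(2)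
    show ?thesis using that(3)
      by (intro R.integrable_const_bound[where B=1]) (auto simp: prob_space.prob_le_1[OF prob_iter])
  qed
  \<comment> \<open>Invariance writes \<open>measure M A\<close> as the \<open>M\<close>-average of
    \<open>measure (kernel_iter k n y) A\<close>, so the difference is an average of distances
    between two starting points.\<close>
  have iter_E: "\<bar>measure (kernel_iter k n x) A - measure M A\<bar> \<le> E n x" if A: "A \<in> sets borel" for n x A
  proof -
    have "measure (kernel_iter k n x) A - measure M A
        = (\<integral>y. measure (kernel_iter k n x) A - measure (kernel_iter k n y) A \<partial>M)"
      using iter_int[OF M.finite_measure_axioms sets_M A, of n]
      by (simp add: M_iter[OF A, of n] M.prob_space)
    also have "\<bar>\<dots>\<bar> \<le> (\<integral>y. \<bar>measure (kernel_iter k n x) A - measure (kernel_iter k n y) A\<bar> \<partial>M)"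
      by (rule integral_abs_bound)
    also have "\<dots> \<le> E n x"
      unfolding E_def using iter_int[OF M.finite_measure_axioms sets_M A, of n]
      by (intro integral_mono int_D D_ge A) auto
    finally show ?thesis .
  qed
  have bind_E: "\<bar>measure (R \<bind> kernel_iter k n) A - measure R UNIV * measure M A\<bar> \<le> (\<integral>x. E n x \<partial>R)"
    and E_int_lim: "(\<lambda>n. \<integral>x. E n x \<partial>R) \<longlonglongrightarrow> 0"
    if R: "finite_measure R" "sets R = sets borel" and A: "A \<in> sets borel" for R n A
  proof -
    interpret R: finite_measure R by fact
    note [measurable_cong] = R(2)
    have sp: "space R = UNIV" using sets_eq_imp_space_eq[OF R(2)] by simp
    have int_E: "integrable R (E n)"
      by (rule R.integrable_const_bound[where B=1]) (auto simp: E01)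
    have "measure (R \<bind> kernel_iter k n) A - measure R UNIV * measure M A
        = (\<integral>x. measure (kernel_iter k n x) A - measure M A \<partial>R)"
      using iter_int[OF R A, of n]
      by (simp add: bind_kernel_borel(3)[OF measurable_kernel_iter[OF kernel] R A] sp)
    also have "\<bar>\<dots>\<bar> \<le> (\<integral>x. \<bar>measure (kernel_iter k n x) A - measure M A\<bar> \<partial>R)"
      by (rule integral_abs_bound)
    also have "\<dots> \<le> (\<integral>x. E n x \<partial>R)"
      using iter_int[OF R A, of n] by (intro integral_mono int_E iter_E A) auto
    finally show "\<bar>measure (R \<bind> kernel_iter k n) A - measure R UNIV * measure M A\<bar> \<le> (\<integral>x. E n x \<partial>R)" .
    have "(\<lambda>n. \<integral>x. E n x \<partial>R) \<longlonglongrightarrow> (\<integral>x. 0 \<partial>R)"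
      by (rule integral_dominated_convergence[where w="\<lambda>_. 1"]) (auto simp: E01 E_lim)
    then show "(\<lambda>n. \<integral>x. E n x \<partial>R) \<longlonglongrightarrow> 0" by simp
  qed
  define c where "c n = (\<integral>x. E n x \<partial>P) + (\<integral>x. E n x \<partial>N)" for n
  define \<rho> where "\<rho> n A = (kernel_op k ^^ n) \<nu> A - \<nu> UNIV * \<mu> A" for n A
  \<comment> \<open>The limit is split as well: \<open>\<nu> UNIV\<close> is the difference of the
    masses of \<open>P\<close> and \<open>N\<close>, so each part is compared with its own mass
    times \<open>M\<close>.\<close>
  have \<rho>: "\<rho> n A = (measure (P \<bind> kernel_iter k n) A - measure P UNIV * measure M A)
      - (measure (N \<bind> kernel_iter k n) A - measure N UNIV * measure M A)" if "A \<in> sets borel" for n A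
  proof -
    have "(kernel_op k ^^ n) \<nu> A = measure (P \<bind> kernel_iter k n) A - measure (N \<bind> kernel_iter k n) A"
      by (rule kernel_op_funpow_eq[OF kernel P N eq that])
    moreover have "\<nu> UNIV = measure P UNIV - measure N UNIV" by (rule eq) simp
    ultimately show ?thesis
      unfolding \<rho>_def \<mu>[OF that] by (simp only: left_diff_distrib)
  qed
  have bound: "\<bar>\<rho> n A\<bar> \<le> c n" if "A \<in> sets borel" for n A
    using bind_E[OF P that, of n] bind_E[OF N that, of n] unfolding \<rho>[OF that] c_def by linarith
  have add: "\<rho> n (A \<union> B) = \<rho> n A + \<rho> n B" if "A \<in> sets borel" "B \<in> sets borel" "A \<inter> B = {}" for n A B
  proof -
    have "measure R (A \<union> B) = measure R A + measure R B" if "finite_measure R" "sets R = sets borel" for R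
      using finite_measure.finite_measure_Union[OF that(1), of A B] that(2) \<open>A \<in> sets borel\<close> \<open>B \<in> sets borel\<close> \<open>A \<inter> B = {}\<close>
      by simp
    note this[OF bind_kernel_borel(1,2)[OF measurable_kernel_iter[OF kernel] P]]
      this[OF bind_kernel_borel(1,2)[OF measurable_kernel_iter[OF kernel] N]]
      this[OF M.finite_measure_axioms sets_M]
    then show ?thesis using that by (simp add: \<rho> algebra_simps)
  qed
  have "(\<lambda>n. tv_norm (\<rho> n)) \<longlonglongrightarrow> 0"
  proof (rule tendsto_sandwich)
    show "\<forall>\<^sub>F n in sequentially. 0 \<le> tv_norm (\<rho> n)"
      by (intro always_eventually allI tv_norm_bounds(1)[OF add bound])
    show "\<forall>\<^sub>F n in sequentially. tv_norm (\<rho> n) \<le> 2 * c n"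
      by (intro always_eventually allI tv_norm_bounds(2)[OF add bound])
    have "c \<longlonglongrightarrow> 0 + 0"
      unfolding c_def[abs_def] by (intro tendsto_add E_int_lim[OF P, of UNIV] E_int_lim[OF N, of UNIV]) auto
    from tendsto_mult_left[OF this, of 2] show "(\<lambda>n. 2 * c n) \<longlonglongrightarrow> 0" by simp
  qed simp
  then show ?thesis unfolding \<rho>_def[abs_def] .
qed

end

section \<open>Passage from the set functions of the statement to Borel measures\<close>

theorem theorem4p5:
  fixes k :: "'a::polish_space \<Rightarrow> 'a measure"
    and \<mu> :: "'a set \<Rightarrow> real"
  assumes prob: "\<And>x. prob_space (k x)"
    and sets_k: "\<And>x. sets (k x) = sets borel"
    and meas_k: "\<And>A. A \<in> sets borel \<Longrightarrow> (\<lambda>x. measure (k x) A) \<in> borel_measurable borel"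
    and equiv: "\<And>x y A. A \<in> sets borel \<Longrightarrow> emeasure (k x) A = 0 \<longleftrightarrow> emeasure (k y) A = 0"
    and mu_sm: "signed_measure \<mu>"
    and mu_nonneg: "\<And>A. A \<in> sets borel \<Longrightarrow> \<mu> A \<ge> 0"
    and mu_prob: "\<mu> UNIV = 1"
    and mu_inv: "\<And>A. A \<in> sets borel \<Longrightarrow> kernel_op k \<mu> A = \<mu> A"
  shows "\<forall>\<nu>. signed_measure \<nu> \<longrightarrow>
           (\<lambda>n. tv_norm (\<lambda>A. ((kernel_op k ^^ n) \<nu>) A - \<nu> UNIV * \<mu> A)) \<longlonglongrightarrow> 0"
proof (intro allI impI)
  fix \<nu> :: "'a set \<Rightarrow> real" assume \<nu>: "signed_measure \<nu>"
  have k: "k \<in> borel \<rightarrow>\<^sub>M prob_algebra borel"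
  proof (intro measurable_prob_algebraI prob measurable_subprob_algebra prob_space_imp_subprob_space sets_k)
    fix A :: "'a set" assume "A \<in> sets borel"
    then show "(\<lambda>x. emeasure (k x) A) \<in> borel_measurable borel"
      using meas_k[of A]
      by (simp add: finite_measure.emeasure_eq_measure[OF prob_space.finite_measure[OF prob]])
  qed
  define M where "M = jordan_pos \<mu>"
  have fin_M: "finite_measure M" and sets_M: "sets M = sets borel"
    unfolding M_def by (simp_all add: finite_measure_jordan_pos[OF mu_sm])
  \<comment> \<open>Nonnegativity of \<mu> makes its negative part vanish on Borel sets, so that
    \<mu> agrees there with the measure \<open>M\<close>.\<close>
  have "measure (jordan_neg \<mu>) A = 0" if A: "A \<in> sets borel" for A
  proof -
    have "Sup {- \<mu> B | B. B \<in> sets borel \<and> B \<subseteq> A} \<le> 0"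
      using mu_nonneg by (intro cSup_least) auto
    then show ?thesis
      unfolding jordan_neg_eq using measure_jordan_pos[OF signed_measure_uminus[OF mu_sm] A]
        measure_nonneg[of "jordan_pos (\<lambda>A. - \<mu> A)" A] by linarith
  qed
  then have \<mu>: "\<mu> A = measure M A" if "A \<in> sets borel" for A
    using jordan_decomposition[OF mu_sm that] that by (simp add: M_def)
  have space_M: "space M = UNIV" using sets_eq_imp_space_eq[OF sets_M] by simp
  have prob_M: "prob_space M"
    using mu_prob \<mu>[of UNIV] space_M finite_measure.emeasure_eq_measure[OF fin_M]
    by (intro prob_spaceI) simp
  have inv: "M \<bind> k = M"
  proof (rule measure_eqI)
    show sets: "sets (M \<bind> k) = sets M"
      using bind_kernel_borel(2)[OF k fin_M sets_M] sets_M by simp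
    fix A assume "A \<in> sets (M \<bind> k)"
    then have A: "A \<in> sets borel" using sets sets_M by simp
    \<comment> \<open>The null measure serves as the subtracted part of \<mu>; with it
      \<open>kernel_op_eq\<close> turns the invariance of the set function into
      \<open>M \<bind> k = M\<close>.\<close>
    have fin0: "finite_measure (null_measure borel :: 'a measure)" by (rule finite_measureI) simp
    have "\<mu> A = measure (M \<bind> k) A - measure (null_measure borel \<bind> k) A"
      unfolding mu_inv[OF A, symmetric]
      by (rule kernel_op_eq[OF k fin_M sets_M fin0 _ _ A]) (simp_all add: \<mu> measure_def)
    also have "measure (null_measure borel \<bind> k) A = 0"
      using bind_kernel_borel(3)[OF k fin0 _ A] by (simp add: integral_null_measure)
    finally show "emeasure (M \<bind> k) A = emeasure M A"
      using \<mu>[OF A] finite_measure.emeasure_eq_measure[OF fin_M]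
        finite_measure.emeasure_eq_measure[OF bind_kernel_borel(1)[OF k fin_M sets_M]] by simp
  qed
  interpret equivalent_kernel k M
    by (intro equivalent_kernel.intro k equiv prob_M sets_M inv)
  show "(\<lambda>n. tv_norm (\<lambda>A. (kernel_op k ^^ n) \<nu> A - \<nu> UNIV * \<mu> A)) \<longlonglongrightarrow> 0"
    by (rule kernel_op_funpow_tendsto[OF _ _ _ _ jordan_decomposition[OF \<nu>] \<mu>])
      (simp_all add: jordan_neg_eq finite_measure_jordan_pos \<nu> signed_measure_uminus)
qed

end
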